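(* Let $L$ be a positive even integer. Then there is a vector $\Theta_L\in\mathcal{H}_{\mathrm{tot}}(0)$ which is positive in the Hulthén bracket (Temperley-Lieb) basis, i.e. $$\Theta_L=\sum_{(\boldsymbol{\alpha},\boldsymbol{\beta})\in\mathcal{M}_L} c(\boldsymbol{\alpha},\boldsymbol{\beta})\,\Phi_L(\boldsymbol{\alpha},\boldsymbol{\beta})\quad\text{with } c(\boldsymbol{\alpha},\boldsymbol{\beta})>0 \text{ for every } (\boldsymbol{\alpha},\boldsymbol{\beta})\in\mathcal{M}_L,$$ such that $$H_L^{\mathrm{FM}}\,\Theta_L=E_{\min}^{\mathrm{FM}}(0;L)\,\Theta_L .$$ Moreover, this eigenvector is non-degenerate within the spin singlet sector: $$\left\{\psi\in\mathcal{H}_{\mathrm{tot}}(0)\,:\,H_L^{\mathrm{FM}}\psi=E_{\min}^{\mathrm{FM}}(0;L)\,\psi\right\}=\operatorname{span}(\Theta_L).$$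
   Context: Let $L$ be even and $\mathcal{H}_{\mathrm{tot}}=(\mathbb{C}^2)^{\otimes L}$, with tensor factors (sites) labelled $1,\dots,L$. On $\mathbb{C}^2$ with orthonormal basis $\Psi_{1/2,1/2},\Psi_{1/2,-1/2}$, let $S^{(1)}=\begin{bmatrix}0&1/2\\1/2&0\end{bmatrix}$, $S^{(2)}=\begin{bmatrix}0&-i/2\\i/2&0\end{bmatrix}$, $S^{(3)}=\begin{bmatrix}1/2&0\\0&-1/2\end{bmatrix}$, $S^{\pm}=S^{(1)}\pm iS^{(2)}$; $S^{(\nu)}_\alpha$ and $S^\pm_\alpha$ denote these operators acting on the $\alpha$-th tensor factor (identity on the others). The Heisenberg ferromagnet on the ring is $$H_L^{\mathrm{FM}}=\sum_{\alpha=1}^{L}\Big(\tfrac14\mathbf{1}-S^{(1)}_\alpha S^{(1)}_{[\alpha+1]}-S^{(2)}_\alpha S^{(2)}_{[\alpha+1]}-S^{(3)}_\alpha S^{(3)}_{[\alpha+1]}\Big),$$ where $[\alpha+1]=\alpha+1$ for $\alpha<L$ and $[L+1]=1$. Let $S^{(\nu)}_{\mathrm{tot}}=\sum_{\alpha=1}^L S^{(\nu)}_\alpha$, $\mathcal{C}_{\mathrm{tot}}=\sum_{\nu=1}^3 (S^{(\nu)}_{\mathrm{tot}})^2$, and for $S\in\{0,1,\dots,L/2\}$ let $\mathcal{H}_{\mathrm{tot}}(S)=\{\psi\in\mathcal{H}_{\mathrm{tot}}:\mathcal{C}_{\mathrm{tot}}\psi=S(S+1)\psi\}$, which is invariant under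 $H_L^{\mathrm{FM}}$. Let $$E_{\min}^{\mathrm{FM}}(S;L)=\min\left\{\frac{\langle\psi,H_L^{\mathrm{FM}}\psi\rangle}{\|\psi\|^2}:\psi\in\mathcal{H}_{\mathrm{tot}}(S),\ \psi\neq0\right\}.$$ Hulthén bracket basis of $\mathcal{H}_{\mathrm{tot}}(0)$: let $\mathcal{M}_L$ be the set of non-crossing perfect matchings of $\{1,\dots,L\}$, i.e. families $(\boldsymbol{\alpha},\boldsymbol{\beta})=((\alpha_1,\beta_1),\dots,(\alpha_{L/2},\beta_{L/2}))$ with $\{\alpha_1,\dots,\alpha_{L/2},\beta_1,\dots,\beta_{L/2}\}=\{1,\dots,L\}$, $\alpha_1<\dots<\alpha_{L/2}$, $\alpha_k<\beta_k$ for each $k$, and for distinct $j,k$: $\alpha_k<\alpha_j<\beta_k$ if and only if $\alpha_k<\beta_j<\beta_k$. Define $$\Phi_L(\boldsymbol{\alpha},\boldsymbol{\beta})=\prod_{k=1}^{L/2}\Big(\tfrac{1}{\sqrt2}S^-_{\alpha_k}-\tfrac1{\sqrt2}S^-_{\beta_k}\Big)\,\big(\Psi_{1/2,1/2}\otimes\cdots\otimes\Psi_{1/2,1/2}\big).$$ The vectors $\Phi_L(\boldsymbol{\alpha},\boldsymbol{\beta})$, $(\boldsymbol{\alpha},\boldsymbol{\beta})\in\mathcal{M}_L$, form a basis of $\mathcal{H}_{\mathrm{tot}}(0)$. *)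

theory Defs
  imports "HOL-Analysis.Analysis" "HOL-Library.Function_Algebras"
begin

text \<open>
  The space \<open>(\<complex>\<^sup>2)\<^sup>\<otimes>\<^sup>L\<close> is modelled by coordinates in the product basis. A basis vector
  is a spin configuration on the sites \<open>1, \<dots>, L\<close>; the values \<open>1\<close> and \<open>2\<close> of type \<open>2\<close>
  stand for \<open>\<Psi>\<close> with magnetic quantum numbers
  \<open>1/2\<close> and \<open>-1/2\<close>.
  Sums and differences of states are those of \<^theory>\<open>HOL-Library.Function_Algebras\<close>.
\<close>

definition configs :: "nat \<Rightarrow> (nat \<Rightarrow> 2) set"
  where "configs L = ({1..L} \<rightarrow>\<^sub>E UNIV)"

type_synonym state = "(nat \<Rightarrow> 2) \<Rightarrow> complex"

definition H_tot :: "nat \<Rightarrow> state set"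
  where "H_tot L = {\<psi>. \<forall>\<sigma>. \<sigma> \<notin> configs L \<longrightarrow> \<psi> \<sigma> = 0}"

definition scale_state :: "complex \<Rightarrow> state \<Rightarrow> state"
  where "scale_state c \<psi> = (\<lambda>\<sigma>. c * \<psi> \<sigma>)"

interpretation state: vector_space scale_state
  by unfold_locales (auto simp: scale_state_def algebra_simps)

definition inner_state :: "nat \<Rightarrow> state \<Rightarrow> state \<Rightarrow> complex"
  where "inner_state L \<phi> \<psi> = (\<Sum>\<sigma>\<in>configs L. cnj (\<phi> \<sigma>) * \<psi> \<sigma>)"

definition norm_state :: "nat \<Rightarrow> state \<Rightarrow> real"
  where "norm_state L \<psi> = sqrt (\<Sum>\<sigma>\<in>configs L. (cmod (\<psi> \<sigma>))\<^sup>2)"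

text \<open>
  The \<open>2 \<times> 2\<close> matrix \<open>A\<close> acting on the tensor factor \<open>\<alpha>\<close>; for \<open>\<alpha> \<in> {1..L}\<close> it maps
  \<^term>\<open>H_tot L\<close> to itself.
\<close>

definition site_op :: "complex^2^2 \<Rightarrow> nat \<Rightarrow> state \<Rightarrow> state"
  where "site_op A \<alpha> \<psi> = (\<lambda>\<sigma>. \<Sum>s\<in>UNIV. A $ \<sigma> \<alpha> $ s * \<psi> (\<sigma>(\<alpha> := s)))"

definition spin_matrix :: "3 \<Rightarrow> complex^2^2"
  where "spin_matrix \<nu> =
    (if \<nu> = 1 then vector [vector [0, 1/2], vector [1/2, 0]]
     else if \<nu> = 2 then vector [vector [0, - \<i>/2], vector [\<i>/2, 0]]
     else vector [vector [1/2, 0], vector [0, - 1/2]])"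

definition lowering_matrix :: "complex^2^2"
  where "lowering_matrix = (\<chi> i j. spin_matrix 1 $ i $ j - \<i> * spin_matrix 2 $ i $ j)"

definition spin_op :: "3 \<Rightarrow> nat \<Rightarrow> state \<Rightarrow> state"
  where "spin_op \<nu> \<alpha> = site_op (spin_matrix \<nu>) \<alpha>"

definition lowering_op :: "nat \<Rightarrow> state \<Rightarrow> state"
  where "lowering_op \<alpha> = site_op lowering_matrix \<alpha>"

definition next_site :: "nat \<Rightarrow> nat \<Rightarrow> nat"
  where "next_site L \<alpha> = (if \<alpha> < L then \<alpha> + 1 else 1)"

definition H_FM :: "nat \<Rightarrow> state \<Rightarrow> state"
  where "H_FM L \<psi> = (\<Sum>\<alpha>\<in>{1..L}. scale_state (1/4) \<psi>
    - spin_op 1 \<alpha> (spin_op 1 (next_site L \<alpha>) \<psi>)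
    - spin_op 2 \<alpha> (spin_op 2 (next_site L \<alpha>) \<psi>)
    - spin_op 3 \<alpha> (spin_op 3 (next_site L \<alpha>) \<psi>))"

definition total_spin_op :: "nat \<Rightarrow> 3 \<Rightarrow> state \<Rightarrow> state"
  where "total_spin_op L \<nu> \<psi> = (\<Sum>\<alpha>\<in>{1..L}. spin_op \<nu> \<alpha> \<psi>)"

definition casimir :: "nat \<Rightarrow> state \<Rightarrow> state"
  where "casimir L \<psi> = (\<Sum>\<nu>\<in>UNIV. total_spin_op L \<nu> (total_spin_op L \<nu> \<psi>))"

definition spin_sector :: "nat \<Rightarrow> nat \<Rightarrow> state set"
  where "spin_sector L S =
    {\<psi> \<in> H_tot L. casimir L \<psi> = scale_state (of_nat S * (of_nat S + 1)) \<psi>}"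

text \<open>
  \<open>E_min_FM S L\<close> is the minimum of the Rayleigh quotients, as a least element.
  The inner product in the numerator is real since \<open>H_FM L\<close> is Hermitian on
  \<^term>\<open>H_tot L\<close>; \<^const>\<open>Re\<close> only adjusts the type.
\<close>

definition E_min_FM :: "nat \<Rightarrow> nat \<Rightarrow> real"
  where "E_min_FM S L =
    (LEAST e. e \<in> {Re (inner_state L \<psi> (H_FM L \<psi>)) / (norm_state L \<psi>)\<^sup>2 | \<psi>.
                     \<psi> \<in> spin_sector L S \<and> \<psi> \<noteq> 0})"

text \<open>
  A matching is the list \<open>[(\<alpha>\<^sub>1, \<beta>\<^sub>1), \<dots>, (\<alpha>\<^sub>k, \<beta>\<^sub>k)]\<close> with \<open>k = L/2\<close>, in increasing order
  of the \<open>\<alpha>\<close>'s. Disjointness of the pairs follows from the number of pairs together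
  with the covering condition.
\<close>

definition noncrossing_matchings :: "nat \<Rightarrow> (nat \<times> nat) list set"
  where "noncrossing_matchings L =
    {m. length m = L div 2
      \<and> fst ` set m \<union> snd ` set m = {1..L}
      \<and> sorted_wrt (<) (map fst m)
      \<and> (\<forall>k<length m. fst (m ! k) < snd (m ! k))
      \<and> (\<forall>j<length m. \<forall>k<length m. j \<noteq> k \<longrightarrow>
           (fst (m ! k) < fst (m ! j) \<and> fst (m ! j) < snd (m ! k) \<longleftrightarrow>
            fst (m ! k) < snd (m ! j) \<and> snd (m ! j) < snd (m ! k)))}"

definition all_up :: "nat \<Rightarrow> state"
  where "all_up L = (\<lambda>\<sigma>. if \<sigma> = (\<lambda>\<alpha>\<in>{1..L}. 1) then 1 else 0)"

definition bracket_op :: "nat \<times> nat \<Rightarrow> state \<Rightarrow> state"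
  where "bracket_op p \<psi> =
    scale_state (1 / sqrt 2) (lowering_op (fst p) \<psi>) - scale_state (1 / sqrt 2) (lowering_op (snd p) \<psi>)"

definition bracket_state :: "nat \<Rightarrow> (nat \<times> nat) list \<Rightarrow> state"
  where "bracket_state L m = foldr bracket_op m (all_up L)"

end

theory Submission
  imports Defs
begin

text \<open>
  A bond term of the Hamiltonian is \<open>(1 - swap)/2\<close>. By the Pluecker relation it fixes a matching
  state containing that bond and otherwise maps it to \<open>- 1/2\<close> times the matching state in which the
  two ends of the bond have been joined; in a non-crossing matching the orientation signs always
  combine to a minus sign. So \<open>L - H\<close> acts on the bracket basis by a nonnegative matrix, which is
  irreducible because joining neighbours leads from any non-crossing matching to any other one. The
  Perron vector gives \<open>\<Theta>\<close>. The basis is not orthogonal, so that \<open>\<Theta>\<close> lies at the bottom of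
  the spectrum is obtained from the growth of \<open>(L - H)\<^sup>n \<psi>\<close>, which is log-convex in \<open>n\<close> since
  \<open>L - H\<close> is Hermitian. Independence and spanning of the matching states are triangular with
  respect to the sum of the opening sites, i.e. the first ends of the arcs.
\<close>

section \<open>Perron vectors of irreducible nonnegative matrices\<close>

text \<open>Shifting by \<open>L\<close>, the number of bonds, turns each bond \<open>h\<close> into
  \<open>1 - h\<close>, which kills a matching containing that bond and sends any other matching to
  itself plus half of its join; this makes the diagonal nonnegative as well. The matrix is not
  symmetric, because the bracket basis is not orthogonal, so its Perron root \<open>r\<close> does
  not bound Rayleigh quotients directly. Instead, the coefficients of a singlet are dominated by a
  multiple of the Perron vector, a domination that grows by the factor \<open>r\<close> per step, so
  the norms of (L - H)^n \<psi> are O(r^n). Log-convexity makes the ratios of successive norms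
  nondecreasing, hence already the first ratio is at most \<open>r\<close>. This replaces a
  diagonalisation. Spanning is shown without counting dimensions. The amplitudes of a singlet form a
  function on sets of down spins, and the raising operator makes it harmonic. If such a function
  vanishes on all sets of smaller element sum, it vanishes at every set violating the ballot
  condition; the other balanced sets are exactly the opening sets of matchings.\<close>

lemma finite_convergent_subseq:
  fixes X :: "nat \<Rightarrow> 'i \<Rightarrow> real"
  assumes "finite I" and "\<And>i. i \<in> I \<Longrightarrow> Bseq (\<lambda>n. X n i)"
  shows "\<exists>r. strict_mono (r :: nat \<Rightarrow> nat) \<and> (\<forall>i\<in>I. convergent (\<lambda>n. X (r n) i))"
  using assms
proof (induction I rule: finite_induct)
  case empty
  have "strict_mono (\<lambda>n::nat. n)" by (simp add: strict_mono_def)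
  then show ?case by blast
next
  case (insert i I)
  then obtain r where r: "strict_mono r" "\<forall>j\<in>I. convergent (\<lambda>n. X (r n) j)" by auto
  have "Bseq (\<lambda>n. X (r n) i)"
    using insert.prems[of i] by (auto simp: Bseq_def)
  then have "bounded (range (\<lambda>n. X (r n) i))"
    by (simp add: Bseq_eq_bounded)
  then obtain l s where s: "strict_mono s" "((\<lambda>n. X (r n) i) \<circ> s) \<longlonglongrightarrow> l"
    using bounded_imp_convergent_subsequence by blast
  have "convergent (\<lambda>n. X ((r \<circ> s) n) j)" if "j \<in> insert i I" for j
  proof (cases "j = i")
    case True
    then show ?thesis using s(2) by (auto simp: convergent_def o_def)
  next
    case False
    with that r(2) have "convergent (\<lambda>n. X (r n) j)" by auto
    from convergent_subseq_convergent[OF this s(1)] show ?thesis by (simp add: o_def)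
  qed
  moreover have "strict_mono (r \<circ> s)" using r(1) s(1) by (rule strict_mono_o)
  ultimately show ?case by blast
qed

text \<open>\<open>B j i\<close> is the weight of the step from \<open>i\<close> to
  \<open>j\<close>. Irreducibility is phrased as the absence of proper nonempty subsets closed under
  steps, the form that closure under joins delivers.\<close>

locale nonneg_irreducible =
  fixes I :: "'i set" and B :: "'i \<Rightarrow> 'i \<Rightarrow> real"
  assumes finite_I: "finite I" and I_nonempty: "I \<noteq> {}"
    and B_nonneg: "B j i \<ge> 0"
    and irreducible: "S \<subseteq> I \<Longrightarrow> S \<noteq> {} \<Longrightarrow> S \<noteq> I \<Longrightarrow> \<exists>i\<in>S. \<exists>j\<in>I - S. B j i > 0"
begin

definition app :: "('i \<Rightarrow> real) \<Rightarrow> 'i \<Rightarrow> real"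
  where "app x j = (\<Sum>i\<in>I. B j i * x i)"

lemma app_mono: "(\<And>i. i \<in> I \<Longrightarrow> x i \<le> y i) \<Longrightarrow> app x j \<le> app y j"
  unfolding app_def by (intro sum_mono mult_left_mono) (auto simp: B_nonneg)

lemma app_nonneg: "(\<And>i. i \<in> I \<Longrightarrow> 0 \<le> x i) \<Longrightarrow> 0 \<le> app x j"
  unfolding app_def by (intro sum_nonneg mult_nonneg_nonneg) (auto simp: B_nonneg)

lemma app_fun_upd: "i \<in> I \<Longrightarrow> app (x(i := x i + e)) j = app x j + B j i * e"
proof -
  assume i: "i \<in> I"
  have "app (x(i := x i + e)) j = (\<Sum>k\<in>I. B j k * x k + (if k = i then B j k * e else 0))"
    unfolding app_def by (intro sum.cong) (auto simp: algebra_simps)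
  then show ?thesis using i finite_I by (simp add: sum.distrib app_def)
qed

text \<open>A step leaving the support of \<open>x\<close> would make \<open>app x\<close> positive
  at an index where \<open>x\<close>, and hence \<open>t * x\<close>, vanishes.\<close>

lemma nonneg_eigenvector_pos:
  assumes x: "\<And>i. i \<in> I \<Longrightarrow> 0 \<le> x i" "\<exists>i\<in>I. x i \<noteq> 0"
    and eig: "\<And>j. j \<in> I \<Longrightarrow> app x j = t * x j"
  shows "\<forall>i\<in>I. 0 < x i"
proof (rule ccontr)
  assume neg: "\<not> ?thesis"
  let ?S = "{i\<in>I. x i > 0}"
  have "?S \<noteq> {}" using x by (metis (mono_tags, lifting) empty_Collect_eq less_eq_real_def)
  moreover have "?S \<noteq> I" using neg by auto
  ultimately obtain i j where ij: "i \<in> I" "x i > 0" "j \<in> I" "\<not> x j > 0" "B j i > 0"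
    using irreducible[of ?S] by auto
  then have "x j = 0" using x(1)[of j] by simp
  then have "app x j = 0" using eig ij by simp
  moreover have "B j i * x i \<le> app x j"
    unfolding app_def using ij finite_I x(1) B_nonneg by (intro member_le_sum) auto
  moreover have "0 < B j i * x i" using ij by simp
  ultimately show False by simp
qed

text \<open>The Collatz-Wielandt condition; the largest \<open>t\<close> admitting such an
  \<open>x\<close> is the Perron root.\<close>

definition subeigen :: "real \<Rightarrow> ('i \<Rightarrow> real) \<Rightarrow> bool"
  where "subeigen t x \<longleftrightarrow>
    (\<forall>i\<in>I. 0 \<le> x i) \<and> (\<exists>i\<in>I. x i \<noteq> 0) \<and> (\<forall>j\<in>I. t * x j \<le> app x j)"

text \<open>Normalised to coordinate sum 1, the admissible vectors lie in a compact simplex, so a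
  maximising sequence converges along a subsequence and the non-strict inequalities pass to the
  limit.\<close>

lemma Collatz_Wielandt_attained:
  "\<exists>t x. 0 \<le> t \<and> subeigen t x \<and> (\<forall>s y. subeigen s y \<longrightarrow> s \<le> t)"
proof -
  let ?P = "\<lambda>t x. (\<forall>i\<in>I. 0 \<le> x i) \<and> sum x I = 1 \<and> (\<forall>j\<in>I. t * x j \<le> app x j)"
  define T where "T = {t. \<exists>x. ?P t x}"
  have unit: "s \<in> T" if "subeigen s y" for s y
  proof -
    have y: "\<And>i. i \<in> I \<Longrightarrow> 0 \<le> y i" "\<exists>i\<in>I. y i \<noteq> 0" "\<And>j. j \<in> I \<Longrightarrow> s * y j \<le> app y j"
      using that by (auto simp: subeigen_def)
    have "sum y I \<noteq> 0" using y(1,2) finite_I by (auto simp: sum_nonneg_eq_0_iff)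
    moreover have "sum y I \<ge> 0" using y(1) by (rule sum_nonneg)
    ultimately have pos: "sum y I > 0" by simp
    have "app (\<lambda>i. y i / sum y I) j = app y j / sum y I" for j
      unfolding app_def by (simp add: sum_divide_distrib)
    moreover have "s * (y j / sum y I) \<le> app y j / sum y I" if "j \<in> I" for j
      using divide_right_mono[OF y(3)[OF that], of "sum y I"] pos by simp
    moreover have "(\<Sum>i\<in>I. y i / sum y I) = 1"
      using pos by (simp flip: sum_divide_distrib)
    moreover have "\<forall>i\<in>I. 0 \<le> y i / sum y I" using y(1) pos by simp
    ultimately have "?P s (\<lambda>i. y i / sum y I)" by (intro conjI ballI) presburger+
    then show ?thesis unfolding T_def by (intro CollectI exI)
  qed
  \<comment> \<open>Summing the inequalities over \<open>j\<close> recovers \<open>t\<close>,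
    because the coordinates of \<open>x\<close> sum to 1; as none of them exceeds 1, the sum of all
    entries of the matrix is a bound.\<close>
  have bdd: "t \<le> (\<Sum>j\<in>I. app (\<lambda>_. 1) j)" if "t \<in> T" for t
  proof -
    from that obtain x where x: "?P t x" unfolding T_def mem_Collect_eq ..
    have le1: "x i \<le> 1" if "i \<in> I" for i
      using member_le_sum[of i I x] that x finite_I by auto
    have "t = (\<Sum>j\<in>I. t * x j)" using x by (metis mult.right_neutral sum_distrib_left)
    also have "\<dots> \<le> (\<Sum>j\<in>I. app x j)" using x by (intro sum_mono) auto
    also have "\<dots> \<le> (\<Sum>j\<in>I. app (\<lambda>_. 1) j)" by (intro sum_mono app_mono le1)
    finally show ?thesis .
  qed
  have zero: "0 \<in> T"
    using I_nonempty by (intro unit[of 0 "\<lambda>_. 1"]) (auto simp: subeigen_def intro: app_nonneg)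
  have bdd': "bdd_above T" using bdd by (intro bdd_aboveI) auto
  let ?\<rho> = "Sup T"
  have "?\<rho> \<in> closure T" using zero bdd' by (intro closure_contains_Sup) auto
  then obtain t where t: "\<And>n. t n \<in> T" "t \<longlonglongrightarrow> ?\<rho>"
    by (auto simp: closure_sequential)
  then have "\<forall>n. \<exists>x. ?P (t n) x" by (simp add: T_def)
  then obtain X where X: "\<And>n. ?P (t n) (X n)" by metis
  have X01: "0 \<le> X n i \<and> X n i \<le> 1" if "i \<in> I" for n i
    using member_le_sum[of i I "X n"] that X[of n] finite_I by auto
  have "Bseq (\<lambda>n. X n i)" if "i \<in> I" for i
    using X01[OF that] by (intro BseqI'[of _ 1]) auto
  then obtain r where r: "strict_mono r" "\<forall>i\<in>I. convergent (\<lambda>n. X (r n) i)"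
    using finite_convergent_subseq[OF finite_I, of X] by blast
  then obtain l where l: "\<And>i. i \<in> I \<Longrightarrow> (\<lambda>n. X (r n) i) \<longlonglongrightarrow> l i"
    unfolding convergent_def by metis
  have tr: "(\<lambda>n. t (r n)) \<longlonglongrightarrow> ?\<rho>"
    using LIMSEQ_subseq_LIMSEQ[OF t(2) r(1)] by (simp add: o_def)
  have "0 \<le> ?\<rho>" by (rule cSup_upper[OF zero bdd'])
  have "0 \<le> l i" if "i \<in> I" for i
    using l[OF that] X01[OF that] by (intro LIMSEQ_le_const) auto
  moreover have "sum l I = 1"
  proof -
    have "(\<lambda>n. sum (X (r n)) I) \<longlonglongrightarrow> sum l I" by (intro tendsto_sum l)
    moreover have "(\<lambda>n. sum (X (r n)) I) = (\<lambda>n. 1)" using X by auto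
    ultimately show ?thesis by (simp add: LIMSEQ_const_iff)
  qed
  moreover have "?\<rho> * l j \<le> app l j" if "j \<in> I" for j
  proof (rule LIMSEQ_le)
    show "(\<lambda>n. t (r n) * X (r n) j) \<longlonglongrightarrow> ?\<rho> * l j" by (intro tendsto_mult tr l that)
    show "(\<lambda>n. app (X (r n)) j) \<longlonglongrightarrow> app l j"
      unfolding app_def by (intro tendsto_sum tendsto_mult tendsto_const l)
    show "\<exists>N. \<forall>n\<ge>N. t (r n) * X (r n) j \<le> app (X (r n)) j" using X that by blast
  qed
  moreover have "\<exists>i\<in>I. l i \<noteq> 0"
    using \<open>sum l I = 1\<close> by (metis sum.neutral zero_neq_one)
  ultimately have "subeigen ?\<rho> l" by (simp add: subeigen_def)
  moreover have "s \<le> ?\<rho>" if "subeigen s y" for s y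
    using unit[OF that] by (intro cSup_upper bdd')
  ultimately show ?thesis using \<open>0 \<le> ?\<rho>\<close> by blast
qed

theorem Perron_vector_exists:
  obtains \<rho> v where "0 \<le> \<rho>" and "\<forall>i\<in>I. 0 < v i" and "\<forall>j\<in>I. app v j = \<rho> * v j"
proof -
  obtain t x where tx: "0 \<le> t" "subeigen t x" "\<And>s y. subeigen s y \<Longrightarrow> s \<le> t"
    using Collatz_Wielandt_attained by blast
  then have t: "0 \<le> t" "\<And>i. i \<in> I \<Longrightarrow> 0 \<le> x i" "\<exists>i\<in>I. x i \<noteq> 0"
    "\<And>j. j \<in> I \<Longrightarrow> t * x j \<le> app x j" by (auto simp: subeigen_def)
  let ?strict = "\<lambda>y. {j\<in>I. t * y j < app y j}"
  text \<open>If some inequality were strict, raising a coordinate at a strict index that feeds a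
    non-strict one would enlarge the set of strict indices until it is everything, and then
    \<open>t\<close> could be increased.\<close>
  have full: "\<exists>y. (\<forall>i\<in>I. 0 \<le> y i) \<and> (\<exists>i\<in>I. y i \<noteq> 0) \<and> (\<forall>j\<in>I. t * y j < app y j)"
    if "\<forall>i\<in>I. 0 \<le> y i" "\<exists>i\<in>I. y i \<noteq> 0" "\<forall>j\<in>I. t * y j \<le> app y j" "?strict y \<noteq> {}" for y
    using that
  proof (induction "card (I - ?strict y)" arbitrary: y rule: less_induct)
    case less
    show ?case
    proof (cases "?strict y = I")
      case True
      then show ?thesis using less.prems by blast
    next
      case False
      then obtain i j where ij: "i \<in> ?strict y" "j \<in> I - ?strict y" "B j i > 0"
        using irreducible[of "?strict y"] less.prems(4) by auto
      let ?d = "app y i - t * y i"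
      \<comment> \<open>Raising \<open>y i\<close> by \<open>e\<close> costs \<open>t * e\<close> in
        the inequality at \<open>i\<close>; dividing the slack by \<open>t + 1\<close> keeps the
        cost below the slack, also when \<open>t = 0\<close>.\<close>
      define e where "e = ?d / (t + 1)"
      have e: "e > 0" "t * e < ?d" using ij t(1) by (auto simp: e_def field_simps)
      let ?y = "y(i := y i + e)"
      have i: "i \<in> I" using ij by simp
      have step: "app ?y k = app y k + B k i * e" for k by (rule app_fun_upd[OF i])
      have Bi: "0 \<le> B k i * e" for k using B_nonneg e by simp
      have ile: "t * (y i + e) < app y i + B i i * e" 
        using e Bi[of i] by (simp add: algebra_simps)
      have le': "t * ?y k \<le> app ?y k" if "k \<in> I" for k
        using ile less.prems(3) Bi[of k] that step[of k] by (cases "k = i") auto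
      have less': "t * ?y k < app ?y k" if "k \<in> ?strict y" for k
      proof (cases "k = i")
        case True
        then show ?thesis using ile step[of i] by simp
      next
        case False
        then show ?thesis using Bi[of k] that step[of k] by simp
      qed
      have sub: "?strict y \<subseteq> ?strict ?y" using less' by blast
      have "j \<in> ?strict ?y"
      proof -
        have "j \<noteq> i" "t * y j \<le> app y j" "0 < B j i * e" using ij less.prems(3) e by auto
        then show ?thesis using ij step[of j] by simp
      qed
      then have "I - ?strict ?y \<subset> I - ?strict y"
        using ij(2) sub by blast
      then have "card (I - ?strict ?y) < card (I - ?strict y)"
        using finite_I by (intro psubset_card_mono) auto
      moreover have "\<forall>k\<in>I. t * ?y k \<le> app ?y k" using le' by blast
      moreover have "\<forall>k\<in>I. 0 \<le> ?y k" using less.prems(1) e by (simp add: add_nonneg_nonneg)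
      moreover have "\<exists>k\<in>I. ?y k \<noteq> 0"
      proof
        have "0 \<le> y i" using less.prems(1) i by blast
        then show "?y i \<noteq> 0" using e by simp
      qed (rule i)
      moreover have "?strict ?y \<noteq> {}" using sub ij by blast
      ultimately show ?thesis using less.hyps[of ?y] by blast
    qed
  qed
  have eig: "app x j = t * x j" if "j \<in> I" for j
  proof (rule ccontr)
    assume "app x j \<noteq> t * x j"
    with t(4)[OF that] that have "j \<in> ?strict x" by simp
    then have "?strict x \<noteq> {}" by blast
    with full[of x] t obtain y where y: "\<forall>i\<in>I. 0 \<le> y i" "\<exists>i\<in>I. y i \<noteq> 0"
      "\<forall>j\<in>I. t * y j < app y j" by auto
    \<comment> \<open>\<open>y j\<close> may be 0, hence the denominator \<open>y j + 1\<close>; the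
      least quotient still allows \<open>t\<close> to be raised by \<open>e\<close> at every
      index.\<close>
    let ?q = "\<lambda>j. (app y j - t * y j) / (y j + 1)"
    define e where "e = Min (?q ` I)"
    have "e > 0" unfolding e_def using y finite_I I_nonempty
      by (auto simp: Min_gr_iff intro!: divide_pos_pos add_nonneg_pos)
    have "(t + e) * y k \<le> app y k" if "k \<in> I" for k
    proof -
      have "e \<le> ?q k" unfolding e_def using that finite_I by simp
      then have "e * (y k + 1) \<le> app y k - t * y k"
        using y(1) that by (simp add: pos_le_divide_eq add_nonneg_pos)
      then show ?thesis using \<open>e > 0\<close> by (simp add: algebra_simps)
    qed
    then have "subeigen (t + e) y" using y by (simp add: subeigen_def)
    then have "t + e \<le> t" by (rule tx(3))
    then show False using \<open>e > 0\<close> by simp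
  qed
  have "\<forall>i\<in>I. 0 < x i" using nonneg_eigenvector_pos[of x t] t eig by blast
  then show ?thesis using that t(1) eig by blast
qed

text \<open>The smallest ratio \<open>x i / v i\<close> gives the largest multiple of
  \<open>v\<close> whose subtraction leaves a nonnegative remainder. The remainder satisfies the
  eigenvalue equation and has a zero coordinate, so by \<open>nonneg_eigenvector_pos\<close> it
  vanishes.\<close>

lemma Perron_vector_unique:
  assumes v: "\<forall>i\<in>I. 0 < v i" "\<forall>j\<in>I. app v j = \<rho> * v j"
    and x: "\<forall>j\<in>I. app x j = \<rho> * x j"
  shows "\<exists>t. \<forall>i\<in>I. x i = t * v i"
proof -
  define t where "t = Min ((\<lambda>i. x i / v i) ` I)"
  have "t \<in> (\<lambda>i. x i / v i) ` I" unfolding t_def using finite_I I_nonempty by (intro Min_in) auto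
  then obtain k where k: "k \<in> I" "t = x k / v k" by blast
  have "0 \<le> x i - t * v i" if "i \<in> I" for i
  proof -
    have "t \<le> x i / v i" unfolding t_def using that finite_I by simp
    then show ?thesis using v(1) that by (simp add: pos_le_divide_eq)
  qed
  moreover have "app (\<lambda>i. x i - t * v i) j = \<rho> * (x j - t * v j)" if "j \<in> I" for j
  proof -
    have "app (\<lambda>i. x i - t * v i) j = app x j - t * app v j"
      unfolding app_def by (simp add: algebra_simps sum_subtractf sum_distrib_left)
    then show ?thesis using v x that by (simp add: algebra_simps)
  qed
  moreover have "x k - t * v k = 0" using k v(1) by (auto simp: less_le)
  ultimately have "\<forall>i\<in>I. x i - t * v i = 0"
    using nonneg_eigenvector_pos[of "\<lambda>i. x i - t * v i" \<rho>] k(1) by fastforce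
  then show ?thesis by auto
qed

end

section \<open>Non-crossing matchings\<close>

text \<open>A matching of \<open>X\<close> is encoded as an involution of all naturals that moves
  exactly the points of \<open>X\<close>. Both ends of an arc are then treated alike, and equality
  of matchings is equality of functions. The last clause is the condition imposed on lists of pairs;
  at fixed points \<open>z\<close> it is trivial.\<close>

definition noncrossing :: "nat set \<Rightarrow> (nat \<Rightarrow> nat) \<Rightarrow> bool"
  where "noncrossing X \<pi> \<longleftrightarrow> (\<forall>i. \<pi> (\<pi> i) = i) \<and> (\<forall>i. i \<in> X \<longleftrightarrow> \<pi> i \<noteq> i) \<and>
    (\<forall>c z. c < \<pi> c \<longrightarrow> z \<noteq> c \<longrightarrow> z \<noteq> \<pi> c \<longrightarrow> (c < z \<and> z < \<pi> c \<longleftrightarrow> c < \<pi> z \<and> \<pi> z < \<pi> c))"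

definition openings :: "(nat \<Rightarrow> nat) \<Rightarrow> nat set"
  where "openings \<pi> = {i. i < \<pi> i}"

lemma noncrossing_invol: "noncrossing X \<pi> \<Longrightarrow> \<pi> (\<pi> i) = i"
  and noncrossing_support: "noncrossing X \<pi> \<Longrightarrow> i \<in> X \<longleftrightarrow> \<pi> i \<noteq> i"
  and noncrossing_sides: "noncrossing X \<pi> \<Longrightarrow> c < \<pi> c \<Longrightarrow> z \<noteq> c \<Longrightarrow> z \<noteq> \<pi> c \<Longrightarrow>
    c < z \<and> z < \<pi> c \<longleftrightarrow> c < \<pi> z \<and> \<pi> z < \<pi> c"
  unfolding noncrossing_def by blast+

lemma noncrossing_closed: "noncrossing X \<pi> \<Longrightarrow> i \<in> X \<Longrightarrow> \<pi> i \<in> X"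
  by (metis noncrossing_invol noncrossing_support)

lemma openings_subset: "noncrossing X \<pi> \<Longrightarrow> openings \<pi> \<subseteq> X"
  by (auto simp: openings_def noncrossing_support)

lemma closing_iff: "noncrossing X \<pi> \<Longrightarrow> i \<in> X - openings \<pi> \<longleftrightarrow> \<pi> i < i"
  by (auto simp: openings_def noncrossing_support)

lemma closings_eq_image: "noncrossing X \<pi> \<Longrightarrow> X - openings \<pi> = \<pi> ` openings \<pi>"
proof
  assume n: "noncrossing X \<pi>"
  show "X - openings \<pi> \<subseteq> \<pi> ` openings \<pi>"
  proof
    fix i assume "i \<in> X - openings \<pi>"
    then have "\<pi> i < i" using n closing_iff by blast
    then have "\<pi> i \<in> openings \<pi>" using n by (simp add: openings_def noncrossing_invol)
    then show "i \<in> \<pi> ` openings \<pi>" using n by (metis imageI noncrossing_invol)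
  qed
  show "\<pi> ` openings \<pi> \<subseteq> X - openings \<pi>"
    using n by (auto simp: openings_def noncrossing_invol noncrossing_support)
qed

lemma noncrossing_inj: "noncrossing X \<pi> \<Longrightarrow> inj_on \<pi> A"
  by (metis inj_onI noncrossing_invol)

lemma card_openings:
  assumes "noncrossing X \<pi>" "finite X"
  shows "2 * card (openings \<pi>) = card X"
proof -
  have "card (X - openings \<pi>) = card (openings \<pi>)"
    using assms(1) by (simp add: closings_eq_image card_image noncrossing_inj)
  moreover have "card X = card (openings \<pi>) + card (X - openings \<pi>)"
    using assms openings_subset[OF assms(1)]
    by (metis card_Diff_subset card_mono finite_subset le_add_diff_inverse)
  ultimately show ?thesis by simp
qed

text \<open>Read from left to right, each closing must take the nearest opening that is still free.
  If the partners of a closing \<open>b\<close> differ, say \<open>f b < g b\<close>, then under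
  \<open>f\<close> the opening \<open>g b\<close> lies below the arc ending in \<open>b\<close> and
  closes before \<open>b\<close>, where both matchings already agree.\<close>

lemma noncrossing_eqI:
  assumes n: "noncrossing X \<pi>" "noncrossing X \<pi>'" and op: "openings \<pi> = openings \<pi>'"
  shows "\<pi> = \<pi>'"
proof -
  have step: False
    if n: "noncrossing X f" "noncrossing X g" and op: "openings f = openings g"
    and IH: "\<And>c. c < b \<Longrightarrow> c \<in> X - openings f \<Longrightarrow> f c = g c"
    and b: "b \<in> X - openings f" and less: "f b < g b" for f g b
  proof -
    note inv = noncrossing_invol[OF n(1)] noncrossing_invol[OF n(2)]
    have gb: "g b < b" using closing_iff[OF n(2)] b op by auto
    have "g b \<in> openings g" using gb inv by (simp add: openings_def)
    then have *: "g b < f (g b)" using op by (auto simp: openings_def)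
    have "f b < f (f b)" using less gb inv by simp
    from noncrossing_sides[OF n(1) this, of "g b"] less gb inv
    have lt: "f (g b) < b" by auto
    have "f (g b) \<in> X - openings f" using closing_iff[OF n(1)] * inv by simp
    from IH[OF lt this] inv have "g (f (g b)) = g b" by simp
    then have "f (g b) = b" using inv by metis
    with lt show False by simp
  qed
  have clos: "\<pi> b = \<pi>' b" if "b \<in> X - openings \<pi>" for b
    using that
  proof (induction b rule: less_induct)
    case (less b)
    show ?case
      using step[of \<pi> \<pi>' b] step[of \<pi>' \<pi> b] less n op by (metis linorder_neqE_nat)
  qed
  show ?thesis
  proof
    fix i
    consider "i \<notin> X" | "i \<in> openings \<pi>" | "i \<in> X - openings \<pi>" by blast
    then show "\<pi> i = \<pi>' i"
    proof cases
      case 1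
      then show ?thesis using n by (metis noncrossing_support)
    next
      case 2
      then have "\<pi> i \<in> X - openings \<pi>" using n closings_eq_image by blast
      then show ?thesis using clos n by (metis noncrossing_invol)
    qed (rule clos)
  qed
qed

section \<open>Joining two neighbours on the circle\<close>

text \<open>The second alternative covers the bond that closes the ring, between the smallest and
  the largest point.\<close>

definition adjacent :: "nat set \<Rightarrow> nat \<Rightarrow> nat \<Rightarrow> bool"
  where "adjacent X p q \<longleftrightarrow> p \<in> X \<and> q \<in> X \<and> p < q \<and> (X \<inter> {p<..<q} = {} \<or> X \<subseteq> {p..q})"

text \<open>The action of a Temperley-Lieb generator on link patterns: \<open>p\<close> and
  \<open>q\<close> become partners, and so do their former partners.\<close>

definition join :: "nat \<Rightarrow> nat \<Rightarrow> (nat \<Rightarrow> nat) \<Rightarrow> nat \<Rightarrow> nat"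
  where "join p q \<pi> = (\<lambda>i. if i = p then q else if i = q then p else if i = \<pi> p then \<pi> q
    else if i = \<pi> q then \<pi> p else \<pi> i)"

lemma join_joined: "noncrossing X \<pi> \<Longrightarrow> \<pi> p = q \<Longrightarrow> join p q \<pi> = \<pi>"
  by (auto simp: join_def noncrossing_invol fun_eq_iff)

lemma adjacent_same_side:
  assumes "adjacent X p q" "c \<in> X" "d \<in> X" "c \<notin> {p, q}" "d \<notin> {p, q}" "c < d"
  shows "c < p \<and> p < d \<longleftrightarrow> c < q \<and> q < d"
  using assms unfolding adjacent_def
  by (auto simp: disjoint_iff subset_iff)

text \<open>An arc not ending in \<open>p\<close>, \<open>q\<close> or one of their partners
  separates neither the neighbours \<open>p\<close> and \<open>q\<close> nor a site from its old
  partner, so all four sites lie on the same side of it and it crosses neither new arc. The new arcs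
  do not cross each other, since \<open>p\<close> and \<open>q\<close> are neighbours.\<close>

lemma noncrossing_join:
  assumes n: "noncrossing X \<pi>" and adj: "adjacent X p q"
  shows "noncrossing X (join p q \<pi>)"
proof (cases "\<pi> p = q")
  case True
  then show ?thesis using n by (simp add: join_joined)
next
  case False
  define x y where "x = \<pi> p" and "y = \<pi> q"
  define \<rho> where "\<rho> = join p q \<pi>"
  have X: "p \<in> X" "q \<in> X" "p \<noteq> q" using adj by (auto simp: adjacent_def)
  note inv = noncrossing_invol[OF n] and sup = noncrossing_support[OF n]
    and side = noncrossing_sides[OF n]
  have xy: "\<pi> p = x" "\<pi> x = p" "\<pi> q = y" "\<pi> y = q" "x \<in> X" "y \<in> X"
    using inv n X by (auto simp: x_def y_def noncrossing_closed)
  have dist: "x \<noteq> y" "x \<noteq> p" "x \<noteq> q" "y \<noteq> p" "y \<noteq> q"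
    using X False xy inv sup by (metis, metis, metis, metis, metis)
  have \<rho>: "\<rho> p = q" "\<rho> q = p" "\<rho> x = y" "\<rho> y = x"
    using dist X xy by (auto simp: \<rho>_def join_def)
  have \<rho>': "\<rho> i = \<pi> i" if "i \<notin> {p, q, x, y}" for i
    using that xy by (auto simp: \<rho>_def join_def)
  have \<pi>': "\<pi> i \<notin> {p, q, x, y}" if "i \<notin> {p, q, x, y}" for i
    using that xy inv by (metis insert_iff empty_iff)
  have old: "p' \<in> {p, q, x, y} \<Longrightarrow> (c < p' \<and> p' < \<pi> c) = (c < p \<and> p < \<pi> c)"
    if c: "c \<notin> {p, q, x, y}" "c < \<pi> c" for c p'
  proof -
    have "c \<in> X" using c sup by auto
    then have pq: "(c < p \<and> p < \<pi> c) = (c < q \<and> q < \<pi> c)"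
      using adjacent_same_side[OF adj, of c "\<pi> c"] c \<pi>'[OF c(1)] noncrossing_closed[OF n] by blast
    have "(c < p \<and> p < \<pi> c) = (c < x \<and> x < \<pi> c)" "(c < q \<and> q < \<pi> c) = (c < y \<and> y < \<pi> c)"
      using side[OF c(2), of p] side[OF c(2), of q] c \<pi>'[OF c(1)] xy by auto
    then show "p' \<in> {p, q, x, y} \<Longrightarrow> (c < p' \<and> p' < \<pi> c) = (c < p \<and> p < \<pi> c)"
      using pq by auto
  qed
  have "\<rho> (\<rho> i) = i" for i
  proof (cases "i \<in> {p, q, x, y}")
    case False
    then show ?thesis using \<rho>'[OF False] \<rho>'[OF \<pi>'[OF False]] inv by simp
  qed (use \<rho> in auto)
  moreover have "i \<in> X \<longleftrightarrow> \<rho> i \<noteq> i" for i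
  proof (cases "i \<in> {p, q, x, y}")
    case False
    then show ?thesis using \<rho>'[OF False] sup by simp
  qed (use \<rho> X xy dist in auto)
  moreover have "(c < z \<and> z < \<rho> c) = (c < \<rho> z \<and> \<rho> z < \<rho> c)"
    if c: "c < \<rho> c" "z \<noteq> c" "z \<noteq> \<rho> c" for c z
  proof -
    consider "c = p" | "c = q" | "c \<in> {x, y}" | "c \<notin> {p, q, x, y}" by blast
    then show ?thesis
    proof cases
      case 1
      have z: "z \<noteq> p" "z \<noteq> q" using c 1 \<rho> by auto
      have rz: "\<rho> z \<noteq> p" "\<rho> z \<noteq> q" using z by (metis calculation(1) \<rho>(1,2))+
      have "z \<in> X \<longleftrightarrow> \<rho> z \<in> X" "z \<notin> X \<longrightarrow> \<rho> z = z"
        using calculation by auto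
      then show ?thesis using 1 \<rho> adj z rz unfolding adjacent_def
        by (auto simp: disjoint_iff subset_iff le_less)
    next
      case 2
      then show ?thesis using c \<rho> adj by (auto simp: adjacent_def)
    next
      case 3
      then have cr: "c \<in> {x, y}" "\<rho> c \<in> {x, y}" "c \<in> X" "\<rho> c \<in> X" using \<rho> xy by auto
      show ?thesis
      proof (cases "z \<in> {p, q}")
        case True
        have "(c < p \<and> p < \<rho> c) = (c < q \<and> q < \<rho> c)"
          using adjacent_same_side[OF adj, of c "\<rho> c"] cr dist c(1) by auto
        then show ?thesis using True \<rho> by auto
      next
        case False
        then have z: "z \<notin> {p, q, x, y}" using c 3 \<rho> by auto
        \<comment> \<open>Crossing is symmetric, so it is the untouched arc through \<open>z\<close>
          that is tested against the two ends of the new arc; the cases fix its orientation.\<close>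
        consider "z < \<pi> z" | "\<pi> z < z" | "\<pi> z = z" by linarith
        then show ?thesis
        proof cases
          case 1
          have "(z < c \<and> c < \<pi> z) = (z < \<rho> c \<and> \<rho> c < \<pi> z)"
            using old[OF z 1, of c] old[OF z 1, of "\<rho> c"] cr by blast
          moreover have "\<pi> z \<noteq> c" "\<pi> z \<noteq> \<rho> c" using \<pi>'[OF z] cr by auto
          ultimately show ?thesis using 1 c \<rho>'[OF z] by linarith
        next
          case 2
          then have "\<pi> z < \<pi> (\<pi> z)" using inv by simp
          from old[OF \<pi>'[OF z] this, of c] old[OF \<pi>'[OF z] this, of "\<rho> c"]
          have "(\<pi> z < c \<and> c < z) = (\<pi> z < \<rho> c \<and> \<rho> c < z)"
            using cr inv by auto
          moreover have "\<pi> z \<noteq> c" "\<pi> z \<noteq> \<rho> c" using \<pi>'[OF z] cr by auto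
          ultimately show ?thesis using 2 c \<rho>'[OF z] by linarith
        next
          case 3
          then show ?thesis using \<rho>'[OF z] by simp
        qed
      qed
    next
      case 4
      have c': "c < \<pi> c" using c 4 \<rho>' by simp
      show ?thesis
      proof (cases "z \<in> {p, q, x, y}")
        case True
        then have "\<rho> z \<in> {p, q, x, y}" using \<rho> by auto
        then show ?thesis using old[OF 4 c', of z] old[OF 4 c', of "\<rho> z"] True \<rho>'[OF 4] by simp
      next
        case False
        then show ?thesis using side[OF c', of z] c \<rho>'[OF 4] \<rho>'[OF False] by simp
      qed
    qed
  qed
  ultimately show ?thesis unfolding noncrossing_def \<rho>_def[symmetric] by blast
qed

text \<open>The last hypothesis is the ballot condition: no initial segment has more closings than
  openings. The first closing \<open>b\<close> is matched with the last opening \<open>a\<close>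
  before it. Nothing of \<open>X\<close> lies between them, so this arc can be removed and put back
  without creating a crossing.\<close>

lemma noncrossing_exists:
  assumes "finite X" "U \<subseteq> X" "card (X - U) = card U"
    and "\<And>p. card {x \<in> X - U. x \<le> p} \<le> card {x \<in> U. x \<le> p}"
  shows "\<exists>\<pi>. noncrossing X \<pi> \<and> openings \<pi> = U"
  using assms
proof (induction "card X" arbitrary: X U rule: less_induct)
  case less
  have finU: "finite U" using less.prems finite_subset by blast
  show ?case
  proof (cases "X = {}")
    case True
    then have "noncrossing X (\<lambda>i. i)" "openings (\<lambda>i. i) = U"
      using less.prems by (auto simp: noncrossing_def openings_def)
    then show ?thesis by blast
  next
    case False
    then have "X - U \<noteq> {}"
      using less.prems finU by (metis Diff_empty card_0_eq card.empty)
    define b where "b = Min (X - U)"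
    have b: "b \<in> X - U" "\<And>i. i \<in> X - U \<Longrightarrow> b \<le> i"
      using Min_in[of "X - U"] less.prems(1) \<open>X - U \<noteq> {}\<close> by (auto simp: b_def)
    have "card {x \<in> X - U. x \<le> b} > 0" using b(1) less.prems(1) by (auto simp: card_gt_0_iff)
    then have "card {x \<in> U. x \<le> b} > 0" using less.prems(4)[of b] by linarith
    then have ne: "{x \<in> U. x \<le> b} \<noteq> {}" by (metis card.empty less_irrefl)
    define a where "a = Max {x \<in> U. x \<le> b}"
    have "a \<in> {x \<in> U. x \<le> b}" unfolding a_def using finU ne by (intro Max_in) auto
    then have a: "a \<in> U" "a < b" using b(1) by (auto simp: le_less)
    have a_max: "i \<le> a" if "i \<in> U" "i \<le> b" for i
      unfolding a_def using finU that by (intro Max_ge) auto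
    have between: "i \<notin> X" if "a < i" "i < b" for i
      using that b(2)[of i] a_max[of i] by auto
    let ?X = "X - {a, b}" and ?U = "U - {a}"
    have diff: "?X - ?U = (X - U) - {b}" using a b by auto
    have "card ?X < card X" using a less.prems by (intro psubset_card_mono) auto
    moreover have "card (?X - ?U) = card ?U"
      unfolding diff using b(1) a(1) less.prems(3) by simp
    moreover have "card {x \<in> ?X - ?U. x \<le> p} \<le> card {x \<in> ?U. x \<le> p}" for p
    \<comment> \<open>Before \<open>b\<close> there are no closings at all; from \<open>b\<close>
      on, both counts drop by one.\<close>
    proof (cases "p < b")
      case True
      then have "{x \<in> ?X - ?U. x \<le> p} = {}" unfolding diff using b(2) by force
      then show ?thesis by (simp only: card.empty le0)
    next
      case False
      have e1: "{x \<in> ?X - ?U. x \<le> p} = {x \<in> X - U. x \<le> p} - {b}" unfolding diff by auto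
      have e2: "{x \<in> ?U. x \<le> p} = {x \<in> U. x \<le> p} - {a}" by auto
      have "card {x \<in> ?X - ?U. x \<le> p} = card {x \<in> X - U. x \<le> p} - 1"
        unfolding e1 using b(1) False by (intro card_Diff_singleton) auto
      moreover have "card {x \<in> ?U. x \<le> p} = card {x \<in> U. x \<le> p} - 1"
        unfolding e2 using a False by (intro card_Diff_singleton) auto
      ultimately show ?thesis using less.prems(4)[of p] by simp
    qed
    moreover have "finite ?X" "?U \<subseteq> ?X" using less.prems b(1) by auto
    ultimately obtain \<pi> where \<pi>: "noncrossing ?X \<pi>" "openings \<pi> = ?U"
      using less.hyps[of ?X ?U] by blast
    note inv = noncrossing_invol[OF \<pi>(1)] and sup = noncrossing_support[OF \<pi>(1)]
      and side = noncrossing_sides[OF \<pi>(1)]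
    define \<rho> where "\<rho> = \<pi>(a := b, b := a)"
    have fixed: "\<pi> a = a" "\<pi> b = b" using sup by auto
    have \<rho>: "\<rho> a = b" "\<rho> b = a" using a(2) by (auto simp: \<rho>_def)
    have \<rho>': "\<rho> i = \<pi> i" if "i \<notin> {a, b}" for i using that by (auto simp: \<rho>_def)
    have \<pi>': "\<pi> i \<notin> {a, b}" if "i \<notin> {a, b}" for i
      using that fixed inv by (metis insert_iff empty_iff)
    have "\<rho> (\<rho> i) = i" for i
    proof (cases "i \<in> {a, b}")
      case False
      then show ?thesis using \<rho>'[OF False] \<rho>'[OF \<pi>'[OF False]] inv by simp
    qed (use \<rho> in auto)
    moreover have "i \<in> X \<longleftrightarrow> \<rho> i \<noteq> i" for i
    proof (cases "i \<in> {a, b}")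
      case False
      then show ?thesis using \<rho>'[OF False] sup[of i] by auto
    qed (use \<rho> a b(1) less.prems(2) in auto)
    moreover have "(c < z \<and> z < \<rho> c) = (c < \<rho> z \<and> \<rho> z < \<rho> c)"
      if c: "c < \<rho> c" "z \<noteq> c" "z \<noteq> \<rho> c" for c z
    proof -
      have notin: "\<not> (a < i \<and> i < b)" if "\<pi> i \<noteq> i" for i using between sup that by blast
      consider "c = a" | "c = b" | "c \<notin> {a, b}" by blast
      then show ?thesis
      proof cases
        case 1
        then have "z \<notin> {a, b}" using c \<rho> by auto
        then show ?thesis using 1 \<rho> \<rho>' notin[of z] notin[of "\<pi> z"] inv by (cases "\<pi> z = z") auto
      next
        case 2
        then show ?thesis using c \<rho> a(2) by simp
      next
        case 3
        have c': "c < \<pi> c" "\<pi> c \<notin> {a, b}" using c 3 \<rho>' \<pi>' by auto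
        show ?thesis
        proof (cases "z \<in> {a, b}")
          case True
          have "\<not> (a < c \<and> c < b)" "\<not> (a < \<pi> c \<and> \<pi> c < b)"
            using notin[of c] notin[of "\<pi> c"] inv c' by auto
          then have "(c < a \<and> a < \<pi> c) = (c < b \<and> b < \<pi> c)"
            using 3 c' a(2) by auto
          then show ?thesis using True \<rho> \<rho>'[OF 3] by auto
        next
          case False
          then show ?thesis using side[OF c'(1), of z] c \<rho>' 3 by simp
        qed
      qed
    qed
    ultimately have "noncrossing X \<rho>" unfolding noncrossing_def by blast
    moreover have "openings \<rho> = U"
    proof -
      have "i \<in> openings \<rho> \<longleftrightarrow> i \<in> U" for i
      proof (cases "i \<in> {a, b}")
        case True
        then show ?thesis using a b(1) \<rho> by (auto simp: openings_def)
      next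
        case False
        then have "i \<in> openings \<rho> \<longleftrightarrow> i \<in> openings \<pi>" using \<rho>' by (simp add: openings_def)
        then show ?thesis using False \<pi>(2) by auto
      qed
      then show ?thesis by blast
    qed
    ultimately show ?thesis by blast
  qed
qed

section \<open>Dictionary between involutions and ordered lists of pairs\<close>

definition ring_matchings :: "nat \<Rightarrow> (nat \<Rightarrow> nat) set"
  where "ring_matchings L = {\<pi>. noncrossing {1..L} \<pi>}"

definition matching_list :: "(nat \<Rightarrow> nat) \<Rightarrow> (nat \<times> nat) list"
  where "matching_list \<pi> = map (\<lambda>i. (i, \<pi> i)) (sorted_list_of_set (openings \<pi>))"

lemma finite_openings: "\<pi> \<in> ring_matchings L \<Longrightarrow> finite (openings \<pi>)"
  using openings_subset finite_subset unfolding ring_matchings_def by blast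

lemma set_matching_list: "\<pi> \<in> ring_matchings L \<Longrightarrow> set (matching_list \<pi>) = (\<lambda>i. (i, \<pi> i)) ` openings \<pi>"
  by (simp add: matching_list_def finite_openings)

lemma matching_list_mem:
  assumes "\<pi> \<in> ring_matchings L"
  shows "matching_list \<pi> \<in> noncrossing_matchings L"
proof -
  have n: "noncrossing {1..L} \<pi>" using assms by (simp add: ring_matchings_def)
  note side = noncrossing_sides[OF n]
  let ?m = "matching_list \<pi>" and ?s = "sorted_list_of_set (openings \<pi>)"
  have fin: "finite (openings \<pi>)" using assms by (rule finite_openings)
  have len: "length ?m = card (openings \<pi>)" by (simp add: matching_list_def)
  have nth: "fst (?m ! k) = ?s ! k \<and> snd (?m ! k) = \<pi> (?s ! k) \<and> ?s ! k \<in> openings \<pi>"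
    if "k < length ?m" for k
    using that fin nth_mem[of k ?s] by (simp add: matching_list_def)
  have "length ?m = L div 2" using len card_openings[OF n] by simp
  moreover have "fst ` set ?m \<union> snd ` set ?m = {1..L}"
    unfolding set_matching_list[OF assms] image_image fst_conv snd_conv image_ident
    using closings_eq_image[OF n] openings_subset[OF n] by blast
  moreover have "sorted_wrt (<) (map fst ?m)"
    by (simp add: matching_list_def o_def)
  moreover have "fst (?m ! k) < snd (?m ! k)" if "k < length ?m" for k
    using nth[OF that] by (simp add: openings_def)
  moreover have "fst (?m ! k) < fst (?m ! j) \<and> fst (?m ! j) < snd (?m ! k) \<longleftrightarrow>
      fst (?m ! k) < snd (?m ! j) \<and> snd (?m ! j) < snd (?m ! k)"
    if jk: "j < length ?m" "k < length ?m" "j \<noteq> k" for j k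
  proof -
    note N = nth[OF jk(1)] nth[OF jk(2)]
    have "?s ! j \<noteq> ?s ! k"
      using jk nth_eq_iff_index_eq[of ?s j k] by (simp add: matching_list_def)
    moreover have "?s ! j \<noteq> \<pi> (?s ! k)"
      using N noncrossing_invol[OF n] by (auto simp: openings_def)
    ultimately show ?thesis using N side[of "?s ! k" "?s ! j"] by (simp add: openings_def)
  qed
  ultimately show ?thesis unfolding noncrossing_matchings_def
    by (intro CollectI conjI allI impI) assumption+
qed

lemma matching_list_surj:
  assumes "even L" and m: "m \<in> noncrossing_matchings L"
  shows "\<exists>\<pi>\<in>ring_matchings L. matching_list \<pi> = m"
proof -
  note M = m[unfolded noncrossing_matchings_def mem_Collect_eq]
  have len: "length m = L div 2" and cover: "fst ` set m \<union> snd ` set m = {1..L}"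
    and sorted: "sorted_wrt (<) (map fst m)"
    by (fact M[THEN conjunct1] M[THEN conjunct2, THEN conjunct1]
        M[THEN conjunct2, THEN conjunct2, THEN conjunct1])+
  have less: "fst (m ! k) < snd (m ! k)" if "k < length m" for k
    using M that by (elim conjE) simp
  have nc: "(fst (m ! k) < fst (m ! j) \<and> fst (m ! j) < snd (m ! k)) =
            (fst (m ! k) < snd (m ! j) \<and> snd (m ! j) < snd (m ! k))"
    if "j < length m" "k < length m" "j \<noteq> k" for j k
    using M that by (elim conjE) simp
  have dF: "distinct (map fst m)" using sorted strict_sorted_iff by blast
  have cF: "card (fst ` set m) = L div 2" using distinct_card[OF dF] len by simp
  have cS: "card (snd ` set m) \<le> L div 2"
    using card_length[of "map snd m"] len by simp
  \<comment> \<open>\<open>L div 2\<close> pairs can cover \<open>L\<close> sites only if the second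
    components are distinct and disjoint from the first ones.\<close>
  have "card (fst ` set m \<union> snd ` set m) = L" by (simp add: cover)
  then have "L + card (fst ` set m \<inter> snd ` set m) = L div 2 + card (snd ` set m)"
    using card_Un_Int[of "fst ` set m" "snd ` set m"] cF by simp
  moreover have "L = L div 2 + L div 2" using \<open>even L\<close> by presburger
  ultimately have "card (fst ` set m \<inter> snd ` set m) = 0" "card (snd ` set m) = L div 2"
    using cS by linarith+
  then have disj: "fst ` set m \<inter> snd ` set m = {}" and dS: "distinct (map snd m)"
    using len by (auto intro: card_distinct)
  \<comment> \<open>The partner is looked up in both directions; the default \<open>i\<close> fixes
    the points outside the ring.\<close>
  define \<pi> where "\<pi> i = (case map_of m i of Some b \<Rightarrow> b | None \<Rightarrow>
    (case map_of (map prod.swap m) i of Some a \<Rightarrow> a | None \<Rightarrow> i))" for i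
  have dS': "distinct (map fst (map prod.swap m))" using dS by (simp add: o_def)
  have pair: "\<pi> a = b \<and> \<pi> b = a" if "(a, b) \<in> set m" for a b
  proof
    show "\<pi> a = b" using map_of_is_SomeI[OF dF that] by (simp add: \<pi>_def)
    have "b \<in> snd ` set m" using that by force
    then have "b \<notin> fst ` set m" using disj by blast
    then have "map_of m b = None" by (simp add: map_of_eq_None_iff)
    moreover have "map_of (map prod.swap m) b = Some a"
      using that by (intro map_of_is_SomeI[OF dS']) force
    ultimately show "\<pi> b = a" by (simp add: \<pi>_def)
  qed
  have lt: "a < b" if "(a, b) \<in> set m" for a b
    using that less by (metis fst_conv in_set_conv_nth snd_conv)
  have outside: "\<pi> i = i" if "i \<notin> {1..L}" for i
  proof -
    have "i \<notin> fst ` set m" "i \<notin> snd ` set m" using that cover by blast+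
    then have "map_of m i = None" "map_of (map prod.swap m) i = None"
      by (auto simp: map_of_eq_None_iff image_image)
    then show ?thesis by (simp add: \<pi>_def)
  qed
  have cases: "(i, \<pi> i) \<in> set m \<or> (\<pi> i, i) \<in> set m" if i: "i \<in> {1..L}" for i
  proof -
    have "i \<in> fst ` set m \<union> snd ` set m" using i cover by blast
    then obtain a b where "(a, b) \<in> set m" "i = a \<or> i = b" by force
    then show ?thesis using pair by metis
  qed
  have "\<pi> (\<pi> i) = i" for i
    using cases[of i] pair outside[of i] by (cases "i \<in> {1..L}") metis+
  moreover have "i \<in> {1..L} \<longleftrightarrow> \<pi> i \<noteq> i" for i
    using cases[of i] lt outside[of i] by (metis less_irrefl)
  moreover have "(c < z \<and> z < \<pi> c) = (c < \<pi> z \<and> \<pi> z < \<pi> c)"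
    if c: "c < \<pi> c" "z \<noteq> c" "z \<noteq> \<pi> c" for c z
  proof (cases "z \<in> {1..L}")
    case True
    have "c \<in> {1..L}" using c outside by fastforce
    then have "(c, \<pi> c) \<in> set m" using cases lt c(1) by fastforce
    then obtain k where k: "k < length m" "m ! k = (c, \<pi> c)" by (auto simp: in_set_conv_nth)
    from cases[OF True] obtain j where j: "j < length m" "m ! j = (z, \<pi> z) \<or> m ! j = (\<pi> z, z)"
      by (auto simp: in_set_conv_nth)
    have "j \<noteq> k" using j k c by auto
    from nc[OF j(1) k(1) this] show ?thesis using j(2) k(2) by auto
  qed (simp add: outside)
  ultimately have n: "\<pi> \<in> ring_matchings L"
    unfolding ring_matchings_def noncrossing_def by blast
  have "openings \<pi> = fst ` set m"
  proof
    show "openings \<pi> \<subseteq> fst ` set m"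
    proof
      fix i assume "i \<in> openings \<pi>"
      then have i: "i < \<pi> i" by (simp add: openings_def)
      then have "i \<in> {1..L}" using outside by fastforce
      then have "(i, \<pi> i) \<in> set m" using cases lt i by fastforce
      then show "i \<in> fst ` set m" by force
    qed
    show "fst ` set m \<subseteq> openings \<pi>" using pair lt by (auto simp: openings_def)
  qed
  then have "sorted_list_of_set (openings \<pi>) = map fst m"
    using sorted by (metis list.set_map sorted_list_of_set.idem_if_sorted_distinct strict_sorted_iff)
  then have "matching_list \<pi> = map (\<lambda>p. (fst p, \<pi> (fst p))) m"
    by (simp add: matching_list_def o_def)
  also have "\<dots> = m" using pair by (intro map_idI) (auto simp: prod_eq_iff)
  finally show ?thesis using n by blast
qed

lemma inj_on_matching_list: "inj_on matching_list (ring_matchings L)"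
proof
  fix \<pi> \<pi>' assume n: "\<pi> \<in> ring_matchings L" "\<pi>' \<in> ring_matchings L"
    and "matching_list \<pi> = matching_list \<pi>'"
  then have "fst ` (\<lambda>i. (i, \<pi> i)) ` openings \<pi> = fst ` (\<lambda>i. (i, \<pi>' i)) ` openings \<pi>'"
    using set_matching_list by metis
  then show "\<pi> = \<pi>'"
    using n by (auto simp: image_image ring_matchings_def intro: noncrossing_eqI)
qed

lemma bij_betw_matching_list:
  "even L \<Longrightarrow> bij_betw matching_list (ring_matchings L) (noncrossing_matchings L)"
  unfolding bij_betw_def using inj_on_matching_list matching_list_mem matching_list_surj by blast

lemma finite_ring_matchings: "finite (ring_matchings L)"
proof -
  have "inj_on openings (ring_matchings L)"
    by (auto simp: inj_on_def ring_matchings_def intro: noncrossing_eqI)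
  moreover have "openings ` ring_matchings L \<subseteq> Pow {1..L}"
    using openings_subset by (auto simp: ring_matchings_def)
  ultimately show ?thesis by (metis finite_Pow_iff finite_atLeastAtMost inj_on_finite)
qed

text \<open>Taking the first half of the sites as openings satisfies the ballot condition; this is
  the fully nested matching.\<close>

lemma ring_matchings_nonempty:
  assumes "even L"
  shows "ring_matchings L \<noteq> {}"
proof -
  obtain k where k: "L = 2 * k" using assms by blast
  have d: "{1..L} - {1..k} = {k<..L}" using k by auto
  have "card {x \<in> {k<..L}. x \<le> p} \<le> card {x \<in> {1..k}. x \<le> p}" for p
  proof -
    have "{x \<in> {k<..L}. x \<le> p} = {k<..min L p}" "{x \<in> {1..k}. x \<le> p} = {1..min k p}" by auto
    then show ?thesis using k by (auto simp: min_def)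
  qed
  then have "\<exists>\<pi>. noncrossing {1..L} \<pi> \<and> openings \<pi> = {1..k}"
    using k d by (intro noncrossing_exists) auto
  then show ?thesis by (auto simp: ring_matchings_def)
qed

section \<open>Connectivity of the non-crossing matchings under joins\<close>

text \<open>Locally \<open>(()...)\<close> becomes \<open>()(...)\<close>: with
  \<open>y = \<pi> p\<close>, the arcs from \<open>p\<close> to \<open>y\<close> and from
  \<open>p + 1\<close> to \<open>p + 2\<close> are replaced by arcs from \<open>p\<close> to
  \<open>p + 1\<close> and from \<open>p + 2\<close> to \<open>y\<close>. One opening moves one site
  to the right, and joining \<open>p + 1\<close> with \<open>p + 2\<close> undoes the change. Thus
  \<pi> is a join of a matching with larger sum of openings.\<close>

lemma sum_openings_join_backwards:
  assumes n: "\<pi> \<in> ring_matchings L" and op: "p \<in> openings \<pi>" "Suc p \<in> openings \<pi>"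
    and nx: "\<pi> (Suc p) = Suc (Suc p)"
  defines "\<rho> \<equiv> join p (Suc p) \<pi>"
  shows "\<rho> \<in> ring_matchings L" "join (Suc p) (Suc (Suc p)) \<rho> = \<pi>"
    "\<Sum>(openings \<rho>) = Suc (\<Sum>(openings \<pi>))"
proof -
  have n': "noncrossing {1..L} \<pi>" using n by (simp add: ring_matchings_def)
  note inv = noncrossing_invol[OF n']
  have sub: "openings \<pi> \<subseteq> {1..L}" by (rule openings_subset[OF n'])
  have "adjacent {1..L} p (Suc p)" using op sub by (auto simp: adjacent_def)
  then show "\<rho> \<in> ring_matchings L"
    unfolding \<rho>_def ring_matchings_def using noncrossing_join[OF n'] by simp
  define y where "y = \<pi> p"
  have y: "\<pi> p = y" "\<pi> y = p" "p < y" using op inv by (auto simp: y_def openings_def)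
  have nx': "\<pi> (Suc (Suc p)) = Suc p" using nx inv by metis
  have dist: "y \<noteq> Suc p" "y \<noteq> Suc (Suc p)" using y nx nx' by auto
  then have "Suc (Suc p) < y" using y(3) by simp
  have \<rho>: "\<rho> = \<pi>(p := Suc p, Suc p := p, y := Suc (Suc p), Suc (Suc p) := y)"
    using y nx dist by (auto simp: \<rho>_def join_def fun_eq_iff)
  show "join (Suc p) (Suc (Suc p)) \<rho> = \<pi>"
    using y nx nx' dist by (auto simp: \<rho> join_def fun_eq_iff)
  have "openings \<rho> = insert (Suc (Suc p)) (openings \<pi> - {Suc p})"
    using y nx nx' \<open>Suc (Suc p) < y\<close> by (auto simp: \<rho> openings_def split: if_splits)
  moreover have "Suc (Suc p) \<notin> openings \<pi>" using nx' by (simp add: openings_def)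
  moreover have "\<Sum>(openings \<pi>) = Suc p + \<Sum>(openings \<pi> - {Suc p})"
    using finite_openings[OF n] op(2) by (rule sum.remove)
  ultimately show "\<Sum>(openings \<rho>) = Suc (\<Sum>(openings \<pi>))"
    using finite_openings[OF n] by simp
qed

text \<open>\<open>irr\<close> forbids the pattern \<open>(()\<close> with its last two sites
  matched. The pairs are found from left to right: if the first free site \<open>s\<close> is not
  matched with its successor, the first closing \<open>q\<close> after \<open>s\<close> is matched
  with \<open>q - 1\<close>, and the opening \<open>q - 2\<close> completes the forbidden
  pattern.\<close>

lemma dimer_matching:
  assumes n: "\<pi> \<in> ring_matchings L"
    and irr: "\<And>p. p \<in> openings \<pi> \<Longrightarrow> Suc p \<in> openings \<pi> \<Longrightarrow> \<pi> (Suc p) \<noteq> Suc (Suc p)"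
    and "2 * k \<le> L" "i < k"
  shows "\<pi> (2 * i + 1) = 2 * i + 2"
  using assms(3,4)
proof (induction k arbitrary: i)
  case (Suc k)
  have n': "noncrossing {1..L} \<pi>" using n by (simp add: ring_matchings_def)
  note inv = noncrossing_invol[OF n'] and sup = noncrossing_support[OF n']
    and side = noncrossing_sides[OF n']
  define s where "s = 2 * k + 1"
  have IH: "\<pi> (2 * i + 1) = 2 * i + 2" if "i < k" for i using Suc that by simp
  \<comment> \<open>The sites before \<open>s\<close> are already paired among themselves.\<close>
  have early: "s \<le> \<pi> j" if "s \<le> j" for j
  proof (rule ccontr)
    assume lt: "\<not> s \<le> \<pi> j"
    have "\<pi> j \<in> {1..L}"
      by (metis that lt inv sup)
    then have "1 \<le> \<pi> j" by simp
    then have "\<exists>i. \<pi> j = 2 * i + 1 \<or> \<pi> j = 2 * i + 2" by presburger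
    then obtain i where "\<pi> j = 2 * i + 1 \<or> \<pi> j = 2 * i + 2" by blast
    moreover from this have "i < k" using lt by (auto simp: s_def)
    ultimately have "j = 2 * i + 2 \<or> j = 2 * i + 1" using IH inv by metis
    then show False using \<open>i < k\<close> that by (auto simp: s_def)
  qed
  have inX: "s \<in> {1..L}" using Suc.prems by (simp add: s_def)
  then have s: "s < \<pi> s" using early[of s] sup[of s] by simp
  have "\<pi> s = Suc s"
  proof (rule ccontr)
    assume ne: "\<pi> s \<noteq> Suc s"
    define q where "q = (LEAST q. s < q \<and> \<pi> q < q)"
    have ex: "s < \<pi> s \<and> \<pi> (\<pi> s) < \<pi> s" using s inv by simp
    have q: "s < q" "\<pi> q < q" using LeastI[of "\<lambda>q. s < q \<and> \<pi> q < q", OF ex] by (auto simp: q_def)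
    have "q \<le> \<pi> s" unfolding q_def by (rule Least_le[where P = "\<lambda>q. s < q \<and> \<pi> q < q", OF ex])
    have "\<pi> s \<in> {1..L}" using noncrossing_closed[OF n' inX] .
    have op: "j \<in> openings \<pi>" if "s \<le> j" "j < q" for j
    proof (cases "j = s")
      case False
      then have "\<not> \<pi> j < j" using not_less_Least[of j "\<lambda>q. s < q \<and> \<pi> q < q"] that by (auto simp: q_def)
      moreover have "j \<in> {1..L}" using that inX \<open>q \<le> \<pi> s\<close> \<open>\<pi> s \<in> {1..L}\<close> by auto
      ultimately show ?thesis using sup[of j] by (simp add: openings_def)
    qed (use s in \<open>simp add: openings_def\<close>)
    have qs: "s \<le> \<pi> q" using early q by simp
    \<comment> \<open>Otherwise the arc ending in \<open>q\<close> encloses the opening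
      \<open>q - 1\<close>, whose partner would have to fit between \<open>q - 1\<close> and
      \<open>q\<close>.\<close>
    have "\<pi> q = q - 1"
    proof (rule ccontr)
      assume "\<pi> q \<noteq> q - 1"
      then have "\<pi> q < q - 1" using q by simp
      moreover have "q - 1 < \<pi> (q - 1)" using op[of "q - 1"] q by (simp add: openings_def)
      moreover have "\<pi> (q - 1) \<noteq> q" using \<open>\<pi> q \<noteq> q - 1\<close> inv by metis
      ultimately show False using side[of "\<pi> q" "q - 1"] inv[of q] q by force
    qed
    moreover have "q \<noteq> Suc s" using ne calculation inv[of q] by auto
    ultimately have "\<pi> (Suc (q - 2)) = Suc (Suc (q - 2))" "Suc (q - 2) = q - 1" "s \<le> q - 2"
      using q inv[of q] by (auto simp: Suc_diff_Suc numeral_2_eq_2)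
    then show False using irr[of "q - 2"] op[of "q - 2"] op[of "q - 1"] q by auto
  qed
  then show ?case using IH Suc.prems by (cases "i = k") (auto simp: s_def)
qed simp

text \<open>Joining sites 1 and 2, then 3 and 4, and so on produces the pairs one by one, since a
  join leaves the pairs built earlier intact.\<close>

lemma join_closed_contains_dimer:
  assumes S: "S \<subseteq> ring_matchings L" "S \<noteq> {}"
    and closed: "\<And>\<pi> p. \<pi> \<in> S \<Longrightarrow> 1 \<le> p \<Longrightarrow> p < L \<Longrightarrow> join p (Suc p) \<pi> \<in> S"
    and "2 * k \<le> L"
  shows "\<exists>\<pi>\<in>S. \<forall>i<k. \<pi> (2 * i + 1) = 2 * i + 2"
  using \<open>2 * k \<le> L\<close>
proof (induction k)
  case 0
  then show ?case using S by auto
next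
  case (Suc k)
  then obtain \<pi> where \<pi>: "\<pi> \<in> S" "\<forall>i<k. \<pi> (2 * i + 1) = 2 * i + 2" by auto
  then have inv: "\<pi> (\<pi> i) = i" for i
    using S noncrossing_invol by (auto simp: ring_matchings_def)
  let ?\<rho> = "join (2 * k + 1) (Suc (2 * k + 1)) \<pi>"
  have "?\<rho> \<in> S" using Suc.prems by (intro closed \<pi>(1)) auto
  moreover have "?\<rho> (2 * i + 1) = 2 * i + 2" if "i < Suc k" for i
  proof (cases "i = k")
    case False
    then have "i < k" using that by simp
    then have "\<pi> (2 * i + 1) = 2 * i + 2" using \<pi>(2) by blast
    moreover from this have "2 * i + 1 \<noteq> \<pi> (2 * k + 1)" "2 * i + 1 \<noteq> \<pi> (Suc (2 * k + 1))"
      using inv[of "2 * k + 1"] inv[of "Suc (2 * k + 1)"] \<open>i < k\<close> by auto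
    ultimately show ?thesis using \<open>i < k\<close> by (auto simp: join_def)
  qed (simp add: join_def)
  ultimately show ?case by blast
qed

text \<open>The matching of the pairs \<open>(2i + 1, 2i + 2)\<close> is reached from every matching, and every other
  matching is the join of one with larger sum of openings.\<close>

theorem join_irreducible:
  assumes "even L" and S: "S \<subseteq> ring_matchings L" "S \<noteq> {}"
    and closed: "\<And>\<pi> p. \<pi> \<in> S \<Longrightarrow> 1 \<le> p \<Longrightarrow> p < L \<Longrightarrow> join p (Suc p) \<pi> \<in> S"
  shows "S = ring_matchings L"
proof
  have bound: "\<Sum>(openings \<pi>) \<le> \<Sum>{1..L}" if "\<pi> \<in> ring_matchings L" for \<pi>
    using that openings_subset by (intro sum_mono2) (auto simp: ring_matchings_def)
  show "ring_matchings L \<subseteq> S"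
  proof
    fix \<pi> assume "\<pi> \<in> ring_matchings L"
    then show "\<pi> \<in> S"
    proof (induction "\<Sum>{1..L} - \<Sum>(openings \<pi>)" arbitrary: \<pi> rule: less_induct)
      case less
      note n = less.prems
      show ?case
      proof (cases "\<exists>p. p \<in> openings \<pi> \<and> Suc p \<in> openings \<pi> \<and> \<pi> (Suc p) = Suc (Suc p)")
        case True
        then obtain p where p: "p \<in> openings \<pi>" "Suc p \<in> openings \<pi>" "\<pi> (Suc p) = Suc (Suc p)"
          by blast
        note bk = sum_openings_join_backwards[OF n p]
        have "join p (Suc p) \<pi> \<in> S"
          using less.hyps[OF _ bk(1)] bk(3) bound[OF bk(1)] by simp
        moreover have "Suc (Suc p) \<in> {1..L}"
          using noncrossing_closed[of "{1..L}" \<pi> "Suc p"] openings_subset[of "{1..L}" \<pi>] n p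
          by (auto simp: ring_matchings_def)
        ultimately have "join (Suc p) (Suc (Suc p)) (join p (Suc p) \<pi>) \<in> S"
          using closed[of "join p (Suc p) \<pi>" "Suc p"] by simp
        then show ?thesis using bk(2) by simp
      next
        case False
        obtain k where k: "L = 2 * k" using \<open>even L\<close> by blast
        obtain \<rho> where \<rho>: "\<rho> \<in> S" "\<forall>i<k. \<rho> (2 * i + 1) = 2 * i + 2"
          using join_closed_contains_dimer[OF S closed, of k] k by auto
        have \<pi>: "\<forall>i<k. \<pi> (2 * i + 1) = 2 * i + 2"
          using dimer_matching[OF n] False k by blast
        have "\<pi> j = \<rho> j" for j
        proof (cases "j \<in> {1..L}")
          case True
          have N: "noncrossing {1..L} \<pi>" "noncrossing {1..L} \<rho>"
            using n \<rho>(1) S by (auto simp: ring_matchings_def)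
          define i where "i = (j - 1) div 2"
          have "i < k" "j = 2 * i + 1 \<or> j = 2 * i + 2" using True k by (auto simp: i_def)
          then show ?thesis using \<pi> \<rho>(2) noncrossing_invol[OF N(1)] noncrossing_invol[OF N(2)]
            by metis
        next
          case False
          have N: "noncrossing {1..L} \<pi>" "noncrossing {1..L} \<rho>"
            using n \<rho>(1) S by (auto simp: ring_matchings_def)
          show ?thesis using noncrossing_support[OF N(1)] noncrossing_support[OF N(2)] False by metis
        qed
        then have "\<pi> = \<rho>" by blast
        then show ?thesis using \<rho>(1) by simp
      qed
    qed
  qed
qed (rule S)

section \<open>Bonds and matching states\<close>

lemma sum_state_apply: "(\<Sum>i\<in>A. f i) \<sigma> = (\<Sum>i\<in>A. (f i :: state) \<sigma>)"
  by (induction A rule: infinite_finite_induct) auto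

lemma configs_iff: "\<sigma> \<in> configs L \<longleftrightarrow> (\<forall>i. i \<notin> {1..L} \<longrightarrow> \<sigma> i = undefined)"
  by (auto simp: configs_def PiE_def extensional_def)

lemma configs_upd: "i \<in> {1..L} \<Longrightarrow> \<sigma>(i := s) \<in> configs L \<longleftrightarrow> \<sigma> \<in> configs L"
  by (auto simp: configs_iff)

lemma finite_configs: "finite (configs L)"
  unfolding configs_def by (intro finite_PiE) auto

lemma site_op_apply:
  "site_op A \<alpha> \<psi> \<sigma> = A $ \<sigma> \<alpha> $ 1 * \<psi> (\<sigma>(\<alpha> := 1)) + A $ \<sigma> \<alpha> $ 2 * \<psi> (\<sigma>(\<alpha> := 2))"
  by (simp add: site_op_def sum_2)

lemma spin_matrix_entries:
  "spin_matrix 1 $ 1 $ 1 = 0" "spin_matrix 1 $ 1 $ 2 = 1/2"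
  "spin_matrix 1 $ 2 $ 1 = 1/2" "spin_matrix 1 $ 2 $ 2 = 0"
  "spin_matrix 2 $ 1 $ 1 = 0" "spin_matrix 2 $ 1 $ 2 = - \<i>/2"
  "spin_matrix 2 $ 2 $ 1 = \<i>/2" "spin_matrix 2 $ 2 $ 2 = 0"
  "spin_matrix 3 $ 1 $ 1 = 1/2" "spin_matrix 3 $ 1 $ 2 = 0"
  "spin_matrix 3 $ 2 $ 1 = 0" "spin_matrix 3 $ 2 $ 2 = - 1/2"
  by (simp_all add: spin_matrix_def)

text \<open>Operators act on coordinates, so the amplitude at a configuration with spin down is read
  off at the one with spin up.\<close>

lemma lowering_op_apply: "lowering_op \<alpha> \<psi> \<sigma> = (if \<sigma> \<alpha> = 2 then \<psi> (\<sigma>(\<alpha> := 1)) else 0)"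
  using exhaust_2[of "\<sigma> \<alpha>"]
  by (auto simp: lowering_op_def site_op_apply lowering_matrix_def spin_matrix_entries)

definition exchange :: "nat \<Rightarrow> nat \<Rightarrow> (nat \<Rightarrow> 2) \<Rightarrow> nat \<Rightarrow> 2"
  where "exchange p q \<sigma> = \<sigma>(p := \<sigma> q, q := \<sigma> p)"

definition bond :: "nat \<Rightarrow> nat \<Rightarrow> state \<Rightarrow> state"
  where "bond p q \<psi> = (\<lambda>\<sigma>. (\<psi> \<sigma> - \<psi> (exchange p q \<sigma>)) / 2)"

lemma exchange_commute: "exchange p q = exchange q p"
  by (auto simp: exchange_def fun_eq_iff)

lemma exchange_exchange [simp]: "exchange p q (exchange p q \<sigma>) = \<sigma>"
  by (auto simp: exchange_def fun_eq_iff)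

lemma exchange_configs: "p \<in> {1..L} \<Longrightarrow> q \<in> {1..L} \<Longrightarrow> exchange p q \<sigma> \<in> configs L \<longleftrightarrow> \<sigma> \<in> configs L"
  by (simp add: exchange_def configs_upd)

text \<open>For two spins 1/2 the scalar product of the spin vectors is half the swap minus 1/4;
  checked on the four values of the two spins.\<close>

lemma bond_eq_spins:
  assumes "p \<noteq> q"
  shows "scale_state (1/4) \<psi> - spin_op 1 p (spin_op 1 q \<psi>) - spin_op 2 p (spin_op 2 q \<psi>)
    - spin_op 3 p (spin_op 3 q \<psi>) = bond p q \<psi>"
proof
  fix \<sigma>
  let ?\<tau> = "\<lambda>s t. \<psi> (\<sigma>(p := s, q := t))"
  have site: "site_op A p (site_op A q \<psi>) \<sigma> =
     A $ \<sigma> p $ 1 * (A $ \<sigma> q $ 1 * ?\<tau> 1 1 + A $ \<sigma> q $ 2 * ?\<tau> 1 2) +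
     A $ \<sigma> p $ 2 * (A $ \<sigma> q $ 1 * ?\<tau> 2 1 + A $ \<sigma> q $ 2 * ?\<tau> 2 2)" for A
    using assms by (simp add: site_op_apply)
  have "\<psi> \<sigma> = ?\<tau> (\<sigma> p) (\<sigma> q)" by simp
  moreover have "\<psi> (exchange p q \<sigma>) = ?\<tau> (\<sigma> q) (\<sigma> p)" by (simp add: exchange_def)
  ultimately show "(scale_state (1/4) \<psi> - spin_op 1 p (spin_op 1 q \<psi>) - spin_op 2 p (spin_op 2 q \<psi>)
      - spin_op 3 p (spin_op 3 q \<psi>)) \<sigma> = bond p q \<psi> \<sigma>"
    using exhaust_2[of "\<sigma> p"] exhaust_2[of "\<sigma> q"]
    unfolding bond_def fun_diff_def scale_state_def spin_op_def site
    by (elim disjE) (simp_all only: spin_matrix_entries, simp_all add: field_simps)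
qed

text \<open>Bonds are listed with the smaller site first, because \<open>adjacent\<close> and the
  signs of the brackets refer to that order. The index \<open>L\<close> stands for the bond between
  1 and \<open>L\<close>; for \<open>L = 2\<close> both indices give the same pair, as in the
  Hamiltonian.\<close>

definition bond_lo :: "nat \<Rightarrow> nat \<Rightarrow> nat"
  where "bond_lo L \<alpha> = (if \<alpha> < L then \<alpha> else 1)"

definition bond_hi :: "nat \<Rightarrow> nat \<Rightarrow> nat"
  where "bond_hi L \<alpha> = (if \<alpha> < L then Suc \<alpha> else L)"

lemma adjacent_bond: "2 \<le> L \<Longrightarrow> \<alpha> \<in> {1..L} \<Longrightarrow> adjacent {1..L} (bond_lo L \<alpha>) (bond_hi L \<alpha>)"
  by (auto simp: adjacent_def bond_lo_def bond_hi_def)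

lemma H_FM_eq_bonds:
  assumes "2 \<le> L"
  shows "H_FM L \<psi> = (\<Sum>\<alpha>\<in>{1..L}. bond (bond_lo L \<alpha>) (bond_hi L \<alpha>) \<psi>)"
  unfolding H_FM_def
proof (rule sum.cong)
  fix \<alpha> assume \<alpha>: "\<alpha> \<in> {1..L}"
  then have "\<alpha> \<noteq> next_site L \<alpha>" using assms by (auto simp: next_site_def)
  from bond_eq_spins[OF this, of \<psi>]
  show "scale_state (1/4) \<psi> - spin_op 1 \<alpha> (spin_op 1 (next_site L \<alpha>) \<psi>) -
      spin_op 2 \<alpha> (spin_op 2 (next_site L \<alpha>) \<psi>) - spin_op 3 \<alpha> (spin_op 3 (next_site L \<alpha>) \<psi>) =
      bond (bond_lo L \<alpha>) (bond_hi L \<alpha>) \<psi>"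
    using \<alpha> by (auto simp: bond_def bond_lo_def bond_hi_def next_site_def exchange_commute)
qed simp

text \<open>The amplitude of a single bracket, with the spin of its opening site as first argument:
  positive if the opening is lowered, negative if the closing is.\<close>

definition singlet_weight :: "2 \<Rightarrow> 2 \<Rightarrow> complex"
  where "singlet_weight s t = (if s = t then 0 else if s = 2 then 1 / sqrt 2 else - 1 / sqrt 2)"

lemma singlet_weight_antisym: "singlet_weight s t = - singlet_weight t s"
  using exhaust_2[of s] exhaust_2[of t] by (auto simp: singlet_weight_def)

text \<open>The weight is an antisymmetric form on a plane, so this is the three-term relation
  between 2 by 2 minors.\<close>

lemma singlet_weight_Plucker:
  "singlet_weight a c * singlet_weight b d - singlet_weight b c * singlet_weight a d =
   singlet_weight a b * singlet_weight c d"
  using exhaust_2[of a] exhaust_2[of b] exhaust_2[of c] exhaust_2[of d]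
  by (elim disjE) (simp_all add: singlet_weight_def)

definition matching_state :: "nat \<Rightarrow> (nat \<Rightarrow> nat) \<Rightarrow> state"
  where "matching_state L \<pi> = (\<lambda>\<sigma>. if \<sigma> \<in> configs L
    then \<Prod>i\<in>openings \<pi>. singlet_weight (\<sigma> i) (\<sigma> (\<pi> i)) else 0)"

text \<open>A bracket lowers exactly one of its two sites, and all sites untouched by the list stay
  up. The amplitude therefore factorises over the pairs.\<close>

lemma foldr_bracket_op:
  assumes "fst ` set m \<union> snd ` set m \<subseteq> {1..L}" "distinct (map fst m @ map snd m)"
  shows "foldr bracket_op m (all_up L) \<sigma> =
    (if \<sigma> \<in> configs L \<and> (\<forall>i\<in>{1..L}. i \<notin> fst ` set m \<union> snd ` set m \<longrightarrow> \<sigma> i = 1)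
     then \<Prod>(a, b)\<leftarrow>m. singlet_weight (\<sigma> a) (\<sigma> b) else 0)"
  using assms
proof (induction m arbitrary: \<sigma>)
  case Nil
  have "\<sigma> = (\<lambda>\<alpha>\<in>{1..L}. 1) \<longleftrightarrow> \<sigma> \<in> configs L \<and> (\<forall>i\<in>{1..L}. \<sigma> i = 1)"
    by (auto simp: configs_iff fun_eq_iff)
  then show ?case by (simp add: all_up_def)
next
  case (Cons ab m)
  obtain a b where ab: "ab = (a, b)" by force
  have X: "a \<in> {1..L}" "b \<in> {1..L}" "a \<noteq> b"
    and m: "a \<notin> fst ` set m \<union> snd ` set m" "b \<notin> fst ` set m \<union> snd ` set m"
    using Cons.prems by (auto simp: ab)
  have IH: "foldr bracket_op m (all_up L) \<tau> =
    (if \<tau> \<in> configs L \<and> (\<forall>i\<in>{1..L}. i \<notin> fst ` set m \<union> snd ` set m \<longrightarrow> \<tau> i = 1)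
     then \<Prod>(a, b)\<leftarrow>m. singlet_weight (\<tau> a) (\<tau> b) else 0)" for \<tau>
    using Cons.prems by (intro Cons.IH) auto
  define P where "P = (\<Prod>(a, b)\<leftarrow>m. singlet_weight (\<sigma> a) (\<sigma> b))"
  define C where "C \<longleftrightarrow> \<sigma> \<in> configs L \<and> (\<forall>i\<in>{1..L}. i \<notin> fst ` set (ab # m) \<union> snd ` set (ab # m) \<longrightarrow> \<sigma> i = 1)"
  have prods: "(\<Prod>(a', b')\<leftarrow>m. singlet_weight ((\<sigma>(j := 1)) a') ((\<sigma>(j := 1)) b')) = P"
    if "j \<notin> fst ` set m \<union> snd ` set m" for j
    unfolding P_def
  proof (intro arg_cong[where f = prod_list] map_cong refl)
    fix ab' assume "ab' \<in> set m"
    then have "fst ab' \<noteq> j" "snd ab' \<noteq> j" using that by auto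
    then show "(case ab' of (a', b') \<Rightarrow> singlet_weight ((\<sigma>(j := 1)) a') ((\<sigma>(j := 1)) b')) =
        (case ab' of (a', b') \<Rightarrow> singlet_weight (\<sigma> a') (\<sigma> b'))"
      by (simp add: case_prod_beta)
  qed
  \<comment> \<open>After undoing the lowering at \<open>j\<close>, the remaining brackets leave the
    other site \<open>k\<close> up, which is the extra condition.\<close>
  have lower: "foldr bracket_op m (all_up L) (\<sigma>(j := 1)) = (if C \<and> \<sigma> k = 1 then P else 0)"
    if "(j, k) \<in> {(a, b), (b, a)}" for j k
  proof -
    have j: "j \<in> {1..L}" "j \<notin> fst ` set m \<union> snd ` set m" using that X m by auto
    have "(\<forall>i\<in>{1..L}. i \<notin> fst ` set m \<union> snd ` set m \<longrightarrow> (\<sigma>(j := 1)) i = 1) \<longleftrightarrow>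
      (\<forall>i\<in>{1..L}. i \<notin> fst ` set (ab # m) \<union> snd ` set (ab # m) \<longrightarrow> \<sigma> i = 1) \<and> \<sigma> k = 1"
      using that X m by (auto simp: ab)
    then show ?thesis unfolding IH prods[OF j(2)] configs_upd[OF j(1)] C_def by auto
  qed
  have "foldr bracket_op (ab # m) (all_up L) \<sigma> =
    (1 / sqrt 2) * (if \<sigma> a = 2 then foldr bracket_op m (all_up L) (\<sigma>(a := 1)) else 0) -
    (1 / sqrt 2) * (if \<sigma> b = 2 then foldr bracket_op m (all_up L) (\<sigma>(b := 1)) else 0)"
    by (simp add: ab bracket_op_def scale_state_def lowering_op_apply)
  also have "\<dots> = (if C then singlet_weight (\<sigma> a) (\<sigma> b) * P else 0)"
    using lower[of a b] lower[of b a] exhaust_2[of "\<sigma> a"] exhaust_2[of "\<sigma> b"]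
    by (elim disjE) (simp_all add: singlet_weight_def)
  moreover have "(\<Prod>(a, b)\<leftarrow>ab # m. singlet_weight (\<sigma> a) (\<sigma> b)) = singlet_weight (\<sigma> a) (\<sigma> b) * P"
    by (simp add: ab P_def)
  ultimately show ?case by (simp only: C_def)
qed

lemma bracket_state_matching_list:
  assumes \<pi>: "\<pi> \<in> ring_matchings L"
  shows "bracket_state L (matching_list \<pi>) = matching_state L \<pi>"
proof -
  have n: "noncrossing {1..L} \<pi>" using \<pi> by (simp add: ring_matchings_def)
  let ?m = "matching_list \<pi>" and ?s = "sorted_list_of_set (openings \<pi>)"
  have fin: "finite (openings \<pi>)" using \<pi> by (rule finite_openings)
  have maps: "map fst ?m = ?s" "map snd ?m = map \<pi> ?s" by (simp_all add: matching_list_def o_def)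
  have cov: "fst ` set ?m \<union> snd ` set ?m = {1..L}"
    unfolding set_matching_list[OF \<pi>] image_image fst_conv snd_conv image_ident
    using closings_eq_image[OF n] openings_subset[OF n] by blast
  have dist: "distinct (map fst ?m @ map snd ?m)"
    unfolding maps using fin closings_eq_image[OF n] noncrossing_inj[OF n]
    by (auto simp: distinct_map)
  have "(\<Prod>(a, b)\<leftarrow>?m. singlet_weight (\<sigma> a) (\<sigma> b)) =
      (\<Prod>i\<in>openings \<pi>. singlet_weight (\<sigma> i) (\<sigma> (\<pi> i)))" for \<sigma> :: "nat \<Rightarrow> 2"
    using fin prod.distinct_set_conv_list[of ?s "\<lambda>i. singlet_weight (\<sigma> i) (\<sigma> (\<pi> i))"]
    by (simp add: matching_list_def o_def)
  then show ?thesis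
    unfolding bracket_state_def
    using foldr_bracket_op[of ?m L] cov dist by (auto simp: matching_state_def fun_eq_iff)
qed

text \<open>\<open>min\<close> selects the opening of an arc, whichever of its ends is
  given.\<close>

lemma prod_openings_remove2:
  assumes n: "\<pi> \<in> ring_matchings L" and pq: "p \<in> {1..L}" "q \<in> {1..L}" "p \<noteq> q" "\<pi> p \<noteq> q"
  shows "(\<Prod>i\<in>openings \<pi>. f i) = f (min p (\<pi> p)) * f (min q (\<pi> q)) *
    (\<Prod>i\<in>openings \<pi> - {p, q, \<pi> p, \<pi> q}. (f i :: complex))"
proof -
  have n': "noncrossing {1..L} \<pi>" using n by (simp add: ring_matchings_def)
  note inv = noncrossing_invol[OF n'] and sup = noncrossing_support[OF n']
  have x: "\<pi> p \<noteq> p" "\<pi> q \<noteq> q" "\<pi> p \<noteq> \<pi> q" using pq sup inv by metis+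
  have fin: "finite (openings \<pi>)" using n by (rule finite_openings)
  let ?a = "min p (\<pi> p)" and ?b = "min q (\<pi> q)"
  have ab: "?a \<in> openings \<pi>" "?b \<in> openings \<pi>" "?a \<noteq> ?b"
    using x pq inv[of p] inv[of q] by (auto simp: openings_def min_def)
  have "openings \<pi> - {p, q, \<pi> p, \<pi> q} = openings \<pi> - {?a} - {?b}"
    using x inv[of p] inv[of q] by (auto simp: openings_def min_def split: if_splits)
  moreover have "(\<Prod>i\<in>openings \<pi>. f i) = f ?a * (\<Prod>i\<in>openings \<pi> - {?a}. f i)"
    using fin ab by (intro prod.remove) auto
  moreover have "(\<Prod>i\<in>openings \<pi> - {?a}. f i) = f ?b * (\<Prod>i\<in>openings \<pi> - {?a} - {?b}. f i)"
    using fin ab by (intro prod.remove) auto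
  ultimately show ?thesis by (simp add: mult.assoc)
qed

text \<open>Swapping the two ends of an arc changes the sign of its weight and leaves all other
  factors alone, so half of one minus the swap acts as the identity.\<close>

lemma bond_joined:
  assumes n: "\<pi> \<in> ring_matchings L" and pq: "p \<in> {1..L}" "p < q" "\<pi> p = q"
  shows "bond p q (matching_state L \<pi>) = matching_state L \<pi>"
proof -
  have n': "noncrossing {1..L} \<pi>" using n by (simp add: ring_matchings_def)
  note inv = noncrossing_invol[OF n']
  have q: "q \<in> {1..L}" "\<pi> q = p" using noncrossing_closed[OF n'] pq inv by blast+
  have fin: "finite (openings \<pi>)" using n by (rule finite_openings)
  have p: "p \<in> openings \<pi>" using pq by (simp add: openings_def)
  have "matching_state L \<pi> (exchange p q \<sigma>) = - matching_state L \<pi> \<sigma>" for \<sigma>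
  proof -
    let ?f = "\<lambda>\<sigma> i. singlet_weight (\<sigma> i) (\<sigma> (\<pi> i))"
    have "?f (exchange p q \<sigma>) i = ?f \<sigma> i" if "i \<in> openings \<pi> - {p}" for i
    proof -
      have "i \<noteq> p" "i < \<pi> i" using that by (auto simp: openings_def)
      then have "i \<noteq> q" "\<pi> i \<noteq> p" "\<pi> i \<noteq> q" using pq q inv[of i] by auto
      then show ?thesis using \<open>i \<noteq> p\<close> by (simp add: exchange_def)
    qed
    then have "(\<Prod>i\<in>openings \<pi> - {p}. ?f (exchange p q \<sigma>) i) = (\<Prod>i\<in>openings \<pi> - {p}. ?f \<sigma> i)"
      by (intro prod.cong) auto
    moreover have "?f (exchange p q \<sigma>) p = - ?f \<sigma> p"
      using pq singlet_weight_antisym[of "\<sigma> q" "\<sigma> p"] by (simp add: exchange_def)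
    ultimately have "(\<Prod>i\<in>openings \<pi>. ?f (exchange p q \<sigma>) i) = - (\<Prod>i\<in>openings \<pi>. ?f \<sigma> i)"
      unfolding prod.remove[OF fin p] by simp
    then show ?thesis using pq q exchange_configs[of p L q \<sigma>] by (simp add: matching_state_def)
  qed
  then show ?thesis by (simp add: bond_def fun_eq_iff)
qed

text \<open>Only the two arcs through \<open>p\<close> and \<open>q\<close> notice the swap. By the
  Pluecker relation the difference of their weights is the product of the weights of the two new
  arcs; what remains is to compare orientations.\<close>

lemma bond_matching_state:
  assumes n: "\<pi> \<in> ring_matchings L" and adj: "adjacent {1..L} p q" and npq: "\<pi> p \<noteq> q"
  shows "bond p q (matching_state L \<pi>) = scale_state (- 1/2) (matching_state L (join p q \<pi>))"
proof
  fix \<sigma>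
  have n': "noncrossing {1..L} \<pi>" using n by (simp add: ring_matchings_def)
  note inv = noncrossing_invol[OF n'] and sup = noncrossing_support[OF n']
    and side = noncrossing_sides[OF n']
  have pq: "p \<in> {1..L}" "q \<in> {1..L}" "p < q" "p \<noteq> q" using adj by (auto simp: adjacent_def)
  define x y where "x = \<pi> p" and "y = \<pi> q"
  have xy: "\<pi> p = x" "\<pi> x = p" "\<pi> q = y" "\<pi> y = q" "x \<in> {1..L}" "y \<in> {1..L}"
    using inv pq noncrossing_closed[OF n'] unfolding x_def y_def by blast+
  have dist: "x \<noteq> y" "x \<noteq> p" "x \<noteq> q" "y \<noteq> p" "y \<noteq> q"
    using pq npq xy inv sup by (metis, metis, metis, metis, metis)
  define \<rho> where "\<rho> = join p q \<pi>"
  have \<rho>: "\<rho> p = q" "\<rho> q = p" "\<rho> x = y" "\<rho> y = x"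
    using dist pq xy by (auto simp: \<rho>_def join_def)
  have \<rho>': "\<rho> i = \<pi> i" if "i \<notin> {p, q, x, y}" for i
    using that xy by (auto simp: \<rho>_def join_def)
  have \<rho>n: "\<rho> \<in> ring_matchings L"
    using noncrossing_join[OF n' adj] by (simp add: \<rho>_def ring_matchings_def)
  define R where "R \<sigma> = (\<Prod>i\<in>openings \<pi> - {p, q, x, y}. singlet_weight (\<sigma> i) (\<sigma> (\<pi> i)))"
    for \<sigma> :: "nat \<Rightarrow> 2"
  \<comment> \<open>\<open>w\<close> ignores which end of an arc is the opening; \<open>e\<close>
    restores the sign.\<close>
  define e where "e i j = (if i < j then 1 else - 1 :: complex)" for i j :: nat
  define w where "w \<sigma> i j = singlet_weight (\<sigma> i) (\<sigma> j)" for \<sigma> :: "nat \<Rightarrow> 2" and i j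
  have orient: "singlet_weight (\<sigma> (min i (\<phi> i))) (\<sigma> (\<phi> (min i (\<phi> i)))) = e i j * w \<sigma> i j"
    if "\<phi> i = j" "\<phi> j = i" "i \<noteq> j" for \<phi> i j and \<sigma> :: "nat \<Rightarrow> 2"
    using that singlet_weight_antisym[of "\<sigma> i" "\<sigma> j"] by (auto simp: min_def w_def e_def)
  have val: "(\<Prod>i\<in>openings \<pi>. singlet_weight (\<sigma> i) (\<sigma> (\<pi> i))) =
      e p x * w \<sigma> p x * (e q y * w \<sigma> q y) * R \<sigma>" for \<sigma>
    unfolding prod_openings_remove2[OF n pq(1,2,4) npq] R_def
    using orient[of \<pi> p x \<sigma>] orient[of \<pi> q y \<sigma>] xy dist by simp
  have "\<rho> p \<noteq> x" using \<rho> dist by simp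
  have "i \<in> openings \<rho> \<longleftrightarrow> i \<in> openings \<pi>" if "i \<notin> {p, q, x, y}" for i
    using \<rho>'[OF that] by (simp add: openings_def)
  then have "openings \<rho> - {p, x, \<rho> p, \<rho> x} = openings \<pi> - {p, q, x, y}"
    unfolding \<rho> by blast
  moreover have "(\<Prod>i\<in>openings \<pi> - {p, q, x, y}. singlet_weight (\<sigma> i) (\<sigma> (\<rho> i))) = R \<sigma>"
    unfolding R_def using \<rho>' by (intro prod.cong) auto
  ultimately have val\<rho>: "(\<Prod>i\<in>openings \<rho>. singlet_weight (\<sigma> i) (\<sigma> (\<rho> i))) =
      e p q * w \<sigma> p q * (e x y * w \<sigma> x y) * R \<sigma>"
    unfolding prod_openings_remove2[OF \<rho>n pq(1) xy(5) dist(2)[symmetric] \<open>\<rho> p \<noteq> x\<close>]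
    using orient[of \<rho> p q \<sigma>] orient[of \<rho> x y \<sigma>] \<rho> pq dist by simp
  have R: "R (exchange p q \<sigma>) = R \<sigma>"
    unfolding R_def
  proof (intro prod.cong refl)
    fix i assume i: "i \<in> openings \<pi> - {p, q, x, y}"
    then have "\<pi> i \<noteq> p" "\<pi> i \<noteq> q" using xy inv by auto
    then show "singlet_weight (exchange p q \<sigma> i) (exchange p q \<sigma> (\<pi> i)) =
        singlet_weight (\<sigma> i) (\<sigma> (\<pi> i))"
      using i by (simp add: exchange_def)
  qed
  have Pl: "w \<sigma> p x * w \<sigma> q y - w \<sigma> q x * w \<sigma> p y = w \<sigma> p q * w \<sigma> x y"
    unfolding w_def by (rule singlet_weight_Plucker)
  have ex: "w (exchange p q \<sigma>) p x = w \<sigma> q x" "w (exchange p q \<sigma>) q y = w \<sigma> p y"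
    using dist by (simp_all add: w_def exchange_def)
  \<comment> \<open>Partners on the same side of the bond are nested, hence in reversed order;
    partners on opposite sides must have \<open>x\<close> on the side of \<open>p\<close>, since the
    other arrangement crosses. For the bond closing the ring, non-crossing forces
    \<open>x < y\<close>.\<close>
  have sign: "e p x * e q y = - (e p q * e x y)"
  proof -
    have "{1..L} \<inter> {p<..<q} = {} \<or> {1..L} \<subseteq> {p..q}" using adj by (simp add: adjacent_def)
    then show ?thesis
    proof
      assume A: "{1..L} \<inter> {p<..<q} = {}"
      then have "\<not> (p < x \<and> x < q)" "\<not> (p < y \<and> y < q)" using xy by (auto simp: disjoint_iff)
      then consider "x < p" "y < p" | "x < p" "q < y" | "q < x" "y < p" | "q < x" "q < y"
        using dist by linarith
      then show ?thesis
      proof cases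
        case 1
        then have "\<not> x < y" using side[of x y] xy pq dist by auto
        then show ?thesis using 1 pq by (auto simp: e_def)
      next
        case 2
        then show ?thesis using pq by (auto simp: e_def)
      next
        case 3
        then show ?thesis using side[of p q] xy pq dist by auto
      next
        case 4
        then have "y < x" using side[of p q] xy pq dist by auto
        then show ?thesis using 4 pq by (auto simp: e_def)
      qed
    next
      assume "{1..L} \<subseteq> {p..q}"
      then have "p \<le> x" "x \<le> q" "p \<le> y" "y \<le> q" using xy by (auto simp: subset_iff)
      then have l: "p < x" "x < q" "p < y" "y < q" using dist by auto
      then have "x < y" using side[of p y] xy pq dist by force
      then show ?thesis using l pq by (auto simp: e_def)
    qed
  qed
  have "(e p x * w \<sigma> p x * (e q y * w \<sigma> q y) * R \<sigma> - e p x * w \<sigma> q x * (e q y * w \<sigma> p y) * R \<sigma>) / 2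
      = (e p x * e q y) * (w \<sigma> p x * w \<sigma> q y - w \<sigma> q x * w \<sigma> p y) * R \<sigma> / 2"
    by (simp add: algebra_simps)
  also have "\<dots> = - 1/2 * (e p q * w \<sigma> p q * (e x y * w \<sigma> x y) * R \<sigma>)"
    unfolding sign Pl by (simp add: algebra_simps)
  finally have "\<sigma> \<in> configs L \<Longrightarrow> bond p q (matching_state L \<pi>) \<sigma> =
      - 1/2 * matching_state L \<rho> \<sigma>"
    unfolding bond_def matching_state_def exchange_configs[OF pq(1,2)] val val\<rho> ex R
    by simp
  moreover have "\<sigma> \<notin> configs L \<Longrightarrow> bond p q (matching_state L \<pi>) \<sigma> = - 1/2 * matching_state L \<rho> \<sigma>"
    unfolding bond_def matching_state_def exchange_configs[OF pq(1,2)] by simp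
  ultimately show "bond p q (matching_state L \<pi>) \<sigma> = scale_state (- 1/2) (matching_state L (join p q \<pi>)) \<sigma>"
    unfolding scale_state_def \<rho>_def[symmetric] by blast
qed

section \<open>Configurations as sets of down spins, and triangularity\<close>

definition cfg :: "nat \<Rightarrow> nat set \<Rightarrow> nat \<Rightarrow> 2"
  where "cfg L U = (\<lambda>i. if i \<in> {1..L} then if i \<in> U then 2 else 1 else undefined)"

lemma cfg_configs: "cfg L U \<in> configs L"
  by (simp add: cfg_def configs_iff)

lemma cfg_upd: "x \<in> {1..L} \<Longrightarrow> (cfg L U)(x := 2) = cfg L (insert x U)"
  by (auto simp: cfg_def fun_eq_iff)

lemma configs_cfg: "\<sigma> \<in> configs L \<Longrightarrow> \<exists>U\<subseteq>{1..L}. \<sigma> = cfg L U"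
proof
  assume "\<sigma> \<in> configs L"
  then show "{i \<in> {1..L}. \<sigma> i = 2} \<subseteq> {1..L} \<and> \<sigma> = cfg L {i \<in> {1..L}. \<sigma> i = 2}"
    using exhaust_2 by (auto simp: cfg_def configs_iff fun_eq_iff)
qed

lemma state_eq_zeroI:
  assumes "\<psi> \<in> H_tot L" "\<And>U. U \<subseteq> {1..L} \<Longrightarrow> \<psi> (cfg L U) = 0"
  shows "\<psi> = 0"
proof
  fix \<sigma>
  show "\<psi> \<sigma> = 0 \<sigma>"
    using assms configs_cfg[of \<sigma> L] by (cases "\<sigma> \<in> configs L") (auto simp: H_tot_def)
qed

lemma matching_state_H_tot: "matching_state L \<pi> \<in> H_tot L"
  by (simp add: matching_state_def H_tot_def)

text \<open>A nonzero amplitude means that \<open>U\<close> contains exactly one end of every arc.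
  The element sum is least when this is always the opening.\<close>

lemma matching_state_cfg_nonzero:
  assumes n: "\<pi> \<in> ring_matchings L" and U: "U \<subseteq> {1..L}" and nz: "matching_state L \<pi> (cfg L U) \<noteq> 0"
  shows "\<Sum>(openings \<pi>) \<le> \<Sum>U" and "\<Sum>(openings \<pi>) = \<Sum>U \<Longrightarrow> U = openings \<pi>"
proof -
  have n': "noncrossing {1..L} \<pi>" using n by (simp add: ring_matchings_def)
  note inv = noncrossing_invol[OF n']
  have fin: "finite (openings \<pi>)" using n by (rule finite_openings)
  have sub: "openings \<pi> \<subseteq> {1..L}" by (rule openings_subset[OF n'])
  have one: "i \<in> U \<longleftrightarrow> \<pi> i \<notin> U" if i: "i \<in> openings \<pi>" for i
  proof -
    have "singlet_weight (cfg L U i) (cfg L U (\<pi> i)) \<noteq> 0"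
      using nz fin i by (auto simp: matching_state_def cfg_configs split: if_splits)
    then have "cfg L U i \<noteq> cfg L U (\<pi> i)" by (auto simp: singlet_weight_def)
    moreover have "i \<in> {1..L}" "\<pi> i \<in> {1..L}" using sub i noncrossing_closed[OF n'] by auto
    ultimately show ?thesis by (auto simp: cfg_def split: if_splits)
  qed
  \<comment> \<open>The end of the arc opened at \<open>i\<close> that belongs to
    \<open>U\<close>.\<close>
  define f where "f i = (if i \<in> U then i else \<pi> i)" for i
  have inj: "inj_on f (openings \<pi>)"
    using inv by (auto simp: inj_on_def f_def openings_def split: if_splits) (metis less_asym)+
  have img: "U = f ` openings \<pi>"
  proof
    show "f ` openings \<pi> \<subseteq> U" using one by (auto simp: f_def)
    show "U \<subseteq> f ` openings \<pi>"
    proof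
      fix u assume u: "u \<in> U"
      show "u \<in> f ` openings \<pi>"
      proof (cases "u \<in> openings \<pi>")
        case True
        then have "f u = u" using u by (simp add: f_def)
        then show ?thesis using True by (metis imageI)
      next
        case False
        then obtain i where "i \<in> openings \<pi>" "u = \<pi> i" using u U closings_eq_image[OF n'] by blast
        then show ?thesis using one u by (auto simp: f_def)
      qed
    qed
  qed
  have sumU: "\<Sum>U = (\<Sum>i\<in>openings \<pi>. f i)"
    by (subst img, subst sum.reindex[OF inj]) simp
  have le: "i \<le> f i" if "i \<in> openings \<pi>" for i using that by (simp add: f_def openings_def)
  show "\<Sum>(openings \<pi>) \<le> \<Sum>U" unfolding sumU by (intro sum_mono le)
  assume "\<Sum>(openings \<pi>) = \<Sum>U"
  then have "f i = i" if "i \<in> openings \<pi>" for i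
    using sum_mono_inv[of "\<lambda>i. i" "openings \<pi>" f i] sumU le fin that by simp
  then show "U = openings \<pi>" using img by simp
qed

lemma matching_state_openings: "matching_state L \<pi> (cfg L (openings \<pi>)) \<noteq> 0"
  if n: "\<pi> \<in> ring_matchings L"
proof -
  have n': "noncrossing {1..L} \<pi>" using n by (simp add: ring_matchings_def)
  have "singlet_weight (cfg L (openings \<pi>) i) (cfg L (openings \<pi>) (\<pi> i)) \<noteq> 0"
    if i: "i \<in> openings \<pi>" for i
  proof -
    have "i \<in> {1..L}" "\<pi> i \<in> {1..L} - openings \<pi>"
      using i closings_eq_image[OF n'] openings_subset[OF n'] by auto
    then show ?thesis using i by (simp add: cfg_def singlet_weight_def)
  qed
  then show ?thesis using finite_openings[OF n] by (simp add: matching_state_def cfg_configs)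
qed

text \<open>At the configuration given by the openings of \<pi>, every other matching that
  contributes has a smaller sum of openings, so its coefficient vanishes by induction.\<close>

lemma matching_states_independent:
  assumes zero: "\<And>\<sigma>. (\<Sum>\<pi>\<in>ring_matchings L. x \<pi> * matching_state L \<pi> \<sigma>) = 0"
    and "\<pi> \<in> ring_matchings L"
  shows "x \<pi> = 0"
  using \<open>\<pi> \<in> ring_matchings L\<close>
proof (induction "\<Sum>(openings \<pi>)" arbitrary: \<pi> rule: less_induct)
  case less
  let ?U = "openings \<pi>"
  have U: "?U \<subseteq> {1..L}" using less.prems openings_subset by (auto simp: ring_matchings_def)
  have "x \<rho> * matching_state L \<rho> (cfg L ?U) = 0" if \<rho>: "\<rho> \<in> ring_matchings L - {\<pi>}" for \<rho>
  proof (cases "matching_state L \<rho> (cfg L ?U) = 0")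
    case False
    have \<rho>': "\<rho> \<in> ring_matchings L" using \<rho> by simp
    have "?U \<noteq> openings \<rho>"
      using \<rho> less.prems noncrossing_eqI by (auto simp: ring_matchings_def)
    then have "\<Sum>(openings \<rho>) < \<Sum>?U"
      using matching_state_cfg_nonzero[OF \<rho>' U False] by linarith
    then show ?thesis using less.hyps \<rho>' by simp
  qed simp
  then have "(\<Sum>\<rho>\<in>ring_matchings L - {\<pi>}. x \<rho> * matching_state L \<rho> (cfg L ?U)) = 0"
    by (rule sum.neutral[OF ballI])
  then have "x \<pi> * matching_state L \<pi> (cfg L ?U) = (\<Sum>\<rho>\<in>ring_matchings L. x \<rho> * matching_state L \<rho> (cfg L ?U))"
    using less.prems finite_ring_matchings by (subst sum.remove[of _ \<pi>]) auto
  then show ?case using zero matching_state_openings[OF less.prems] by simp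
qed

section \<open>Singlets\<close>

text \<open>The linear description of total spin 0: three first-order equations instead of the
  quadratic Casimir equation. The equivalence is \<open>spin_sector_0\<close>.\<close>

definition singlets :: "nat \<Rightarrow> state set"
  where "singlets L = {\<psi> \<in> H_tot L. \<forall>\<nu>. total_spin_op L \<nu> \<psi> = 0}"

lemma total_spin_op_apply: "total_spin_op L \<nu> \<psi> \<sigma> = (\<Sum>\<alpha>\<in>{1..L}. spin_op \<nu> \<alpha> \<psi> \<sigma>)"
  unfolding total_spin_op_def by (rule sum_state_apply)

lemma singlets_diff_sum:
  assumes "\<psi> \<in> singlets L" "\<And>i. i \<in> I \<Longrightarrow> \<phi> i \<in> singlets L"
  shows "(\<lambda>\<sigma>. \<psi> \<sigma> - (\<Sum>i\<in>I. x i * \<phi> i \<sigma>)) \<in> singlets L"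
proof -
  have "site_op A \<alpha> (\<lambda>\<sigma>. \<psi> \<sigma> - (\<Sum>i\<in>I. x i * \<phi> i \<sigma>)) \<sigma> =
      site_op A \<alpha> \<psi> \<sigma> - (\<Sum>i\<in>I. x i * site_op A \<alpha> (\<phi> i) \<sigma>)" for A \<alpha> \<sigma>
    unfolding site_op_apply by (simp add: algebra_simps sum_distrib_left sum.distrib)
  then have "total_spin_op L \<nu> (\<lambda>\<sigma>. \<psi> \<sigma> - (\<Sum>i\<in>I. x i * \<phi> i \<sigma>)) \<sigma> =
      total_spin_op L \<nu> \<psi> \<sigma> - (\<Sum>i\<in>I. x i * total_spin_op L \<nu> (\<phi> i) \<sigma>)" for \<nu> \<sigma>
    unfolding total_spin_op_apply spin_op_def sum_distrib_left
    by (simp add: sum_subtractf sum.swap[of _ _ I])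
  then show ?thesis using assms by (auto simp: singlets_def H_tot_def fun_eq_iff)
qed

lemma site_op_H_tot: "\<alpha> \<in> {1..L} \<Longrightarrow> \<psi> \<in> H_tot L \<Longrightarrow> site_op A \<alpha> \<psi> \<in> H_tot L"
  by (simp add: H_tot_def site_op_apply configs_upd)

lemma total_spin_op_H_tot: "\<psi> \<in> H_tot L \<Longrightarrow> total_spin_op L \<nu> \<psi> \<in> H_tot L"
  using site_op_H_tot by (auto simp: H_tot_def total_spin_op_apply spin_op_def intro!: sum.neutral)

lemma site_op_hermitian:
  assumes A: "\<And>s t. A $ s $ t = cnj (A $ t $ s)" and \<alpha>: "\<alpha> \<in> {1..L}"
  shows "inner_state L \<phi> (site_op A \<alpha> \<psi>) = inner_state L (site_op A \<alpha> \<phi>) \<psi>"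
proof -
  let ?S = "configs L \<times> (UNIV :: 2 set)"
  have "inner_state L \<phi> (site_op A \<alpha> \<psi>) =
      (\<Sum>(\<sigma>, s)\<in>?S. cnj (\<phi> \<sigma>) * (A $ \<sigma> \<alpha> $ s * \<psi> (\<sigma>(\<alpha> := s))))"
    by (simp add: inner_state_def site_op_def sum_distrib_left sum.cartesian_product)
  \<comment> \<open>The reindexing exchanges the spin at \<alpha> with the summation index; it is an
    involution on the pairs.\<close>
  also have "\<dots> = (\<Sum>(\<sigma>, s)\<in>?S. cnj (A $ \<sigma> \<alpha> $ s * \<phi> (\<sigma>(\<alpha> := s))) * \<psi> \<sigma>)"
    using \<alpha> by (intro sum.reindex_bij_witness[where i = "\<lambda>(\<sigma>, s). (\<sigma>(\<alpha> := s), \<sigma> \<alpha>)"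
        and j = "\<lambda>(\<sigma>, s). (\<sigma>(\<alpha> := s), \<sigma> \<alpha>)"])
      (auto simp: configs_upd A[symmetric] simp del: complex_cnj_mult,
        simp add: A[symmetric])
  also have "\<dots> = inner_state L (site_op A \<alpha> \<phi>) \<psi>"
    by (simp add: inner_state_def site_op_def sum_distrib_right sum.cartesian_product)
  finally show ?thesis .
qed

lemma spin_matrix_hermitian: "spin_matrix \<nu> $ s $ t = cnj (spin_matrix \<nu> $ t $ s)"
  using exhaust_2[of s] exhaust_2[of t] exhaust_3[of \<nu>]
  by (elim disjE) (simp_all only: spin_matrix_entries, simp_all)

lemma inner_state_sum_right:
  "inner_state L \<phi> (\<Sum>i\<in>I. f i) = (\<Sum>i\<in>I. inner_state L \<phi> (f i))"
  unfolding inner_state_def sum_state_apply sum_distrib_left by (rule sum.swap)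

lemma inner_state_sum_left:
  "inner_state L (\<Sum>i\<in>I. f i) \<psi> = (\<Sum>i\<in>I. inner_state L (f i) \<psi>)"
  unfolding inner_state_def sum_state_apply cnj_sum sum_distrib_right by (rule sum.swap)

lemma total_spin_op_hermitian:
  "inner_state L \<phi> (total_spin_op L \<nu> \<psi>) = inner_state L (total_spin_op L \<nu> \<phi>) \<psi>"
  unfolding total_spin_op_def spin_op_def inner_state_sum_left inner_state_sum_right
  by (intro sum.cong refl site_op_hermitian spin_matrix_hermitian)

lemma inner_state_self: "inner_state L \<psi> \<psi> = of_real ((norm_state L \<psi>)\<^sup>2)"
proof -
  have "(norm_state L \<psi>)\<^sup>2 = (\<Sum>\<sigma>\<in>configs L. (cmod (\<psi> \<sigma>))\<^sup>2)"
    unfolding norm_state_def by (intro real_sqrt_pow2 sum_nonneg) auto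
  then show ?thesis
    by (simp add: inner_state_def mult.commute flip: complex_norm_square)
qed

lemma norm_state_eq_0: "\<psi> \<in> H_tot L \<Longrightarrow> norm_state L \<psi> = 0 \<longleftrightarrow> \<psi> = 0"
  using finite_configs[of L]
  by (auto simp: norm_state_def sum_nonneg_eq_0_iff H_tot_def fun_eq_iff)

text \<open>The expectation of the Casimir operator is the sum of the squared norms of the three
  total spin components applied to \<psi>; if it is 0, each of them vanishes.\<close>

lemma spin_sector_0: "spin_sector L 0 = singlets L"
proof
  show "singlets L \<subseteq> spin_sector L 0"
  proof
    fix \<psi> assume \<psi>: "\<psi> \<in> singlets L"
    have "total_spin_op L \<nu> 0 = 0" for \<nu>
      by (simp add: fun_eq_iff total_spin_op_apply spin_op_def site_op_apply)
    then have "casimir L \<psi> = 0" using \<psi> by (simp add: casimir_def singlets_def)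
    then show "\<psi> \<in> spin_sector L 0"
      using \<psi> by (simp add: spin_sector_def singlets_def scale_state_def fun_eq_iff)
  qed
  show "spin_sector L 0 \<subseteq> singlets L"
  proof
    fix \<psi> assume "\<psi> \<in> spin_sector L 0"
    then have \<psi>: "\<psi> \<in> H_tot L" "casimir L \<psi> = 0"
      by (auto simp: spin_sector_def scale_state_def fun_eq_iff)
    have "inner_state L \<psi> (casimir L \<psi>) =
        (\<Sum>\<nu>\<in>UNIV. inner_state L \<psi> (total_spin_op L \<nu> (total_spin_op L \<nu> \<psi>)))"
      unfolding casimir_def by (rule inner_state_sum_right)
    also have "\<dots> = (\<Sum>\<nu>\<in>UNIV. of_real ((norm_state L (total_spin_op L \<nu> \<psi>))\<^sup>2))"
      by (simp add: total_spin_op_hermitian[of L \<psi>] inner_state_self)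
    finally have "of_real (\<Sum>\<nu>\<in>UNIV. (norm_state L (total_spin_op L \<nu> \<psi>))\<^sup>2) = (0 :: complex)"
      using \<psi>(2) by (simp add: inner_state_def)
    then have "(\<Sum>\<nu>\<in>UNIV. (norm_state L (total_spin_op L \<nu> \<psi>))\<^sup>2) = 0"
      by (simp only: of_real_eq_0_iff)
    then have "norm_state L (total_spin_op L \<nu> \<psi>) = 0" for \<nu>
      by (simp add: sum_nonneg_eq_0_iff)
    then show "\<psi> \<in> singlets L"
      using \<psi>(1) norm_state_eq_0 total_spin_op_H_tot by (auto simp: singlets_def)
  qed
qed

text \<open>The spin operators at the two ends of an arc cancel on its bracket, and the sites of the
  ring are grouped into arcs.\<close>

lemma matching_state_singlet:
  assumes n: "\<pi> \<in> ring_matchings L"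
  shows "matching_state L \<pi> \<in> singlets L"
proof -
  have n': "noncrossing {1..L} \<pi>" using n by (simp add: ring_matchings_def)
  note inv = noncrossing_invol[OF n']
  have fin: "finite (openings \<pi>)" using n by (rule finite_openings)
  have sub: "openings \<pi> \<subseteq> {1..L}" by (rule openings_subset[OF n'])
  have "total_spin_op L \<nu> (matching_state L \<pi>) \<sigma> = 0" for \<nu> \<sigma>
  proof -
    let ?T = "\<lambda>\<alpha>. spin_op \<nu> \<alpha> (matching_state L \<pi>) \<sigma>" and ?A = "spin_matrix \<nu>"
    have "?T a + ?T (\<pi> a) = 0" if a: "a \<in> openings \<pi>" for a
    proof (cases "\<sigma> \<in> configs L")
      case True
      define b where "b = \<pi> a"
      have b: "\<pi> a = b" "a < b" "\<pi> b = a" using a inv by (auto simp: b_def openings_def)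
      have X: "a \<in> {1..L}" "b \<in> {1..L}" using a sub b_def noncrossing_closed[OF n'] by auto
      define R where "R = (\<Prod>i\<in>openings \<pi> - {a}. singlet_weight (\<sigma> i) (\<sigma> (\<pi> i)))"
      have R: "matching_state L \<pi> \<tau> = singlet_weight (\<tau> a) (\<tau> b) * R"
        if \<tau>: "\<tau> \<in> configs L" "\<And>i. i \<noteq> a \<Longrightarrow> i \<noteq> b \<Longrightarrow> \<tau> i = \<sigma> i" for \<tau>
      proof -
        have "(\<Prod>i\<in>openings \<pi> - {a}. singlet_weight (\<tau> i) (\<tau> (\<pi> i))) = R"
          unfolding R_def
        proof (intro prod.cong refl)
          fix i assume i: "i \<in> openings \<pi> - {a}"
          then have "i < \<pi> i" "i \<noteq> a" by (auto simp: openings_def)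
          then have "i \<noteq> b" "\<pi> i \<noteq> b" "\<pi> i \<noteq> a" using b inv[of i] inv[of a] by auto
          then show "singlet_weight (\<tau> i) (\<tau> (\<pi> i)) = singlet_weight (\<sigma> i) (\<sigma> (\<pi> i))"
            using \<tau>(2) \<open>i \<noteq> a\<close> by simp
        qed
        then show ?thesis using \<tau>(1) b by (simp add: matching_state_def prod.remove[OF fin a])
      qed
      have Ta: "matching_state L \<pi> (\<sigma>(a := s)) = singlet_weight s (\<sigma> b) * R" for s
        using R[of "\<sigma>(a := s)"] True X b by (simp add: configs_upd)
      have Tb: "matching_state L \<pi> (\<sigma>(b := s)) = singlet_weight (\<sigma> a) s * R" for s
        using R[of "\<sigma>(b := s)"] True X b by (simp add: configs_upd)
      show ?thesis
        unfolding b(1) spin_op_def site_op_apply Ta Tb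
        using exhaust_2[of "\<sigma> a"] exhaust_2[of "\<sigma> b"] exhaust_3[of \<nu>]
        by (elim disjE) (simp_all only: spin_matrix_entries, simp_all add: singlet_weight_def)
    next
      case False
      have "a \<in> {1..L}" "\<pi> a \<in> {1..L}" using a sub noncrossing_closed[OF n'] by auto
      then show ?thesis using False
        by (simp add: spin_op_def site_op_apply matching_state_def configs_upd)
    qed
    then have "(\<Sum>a\<in>openings \<pi>. ?T a + ?T (\<pi> a)) = 0" by simp
    moreover have "(\<Sum>\<alpha>\<in>{1..L}. ?T \<alpha>) = (\<Sum>a\<in>openings \<pi>. ?T a) + (\<Sum>a\<in>\<pi> ` openings \<pi>. ?T a)"
      using closings_eq_image[OF n', symmetric] sub by (simp add: sum.subset_diff add.commute)
    moreover have "(\<Sum>a\<in>\<pi> ` openings \<pi>. ?T a) = (\<Sum>a\<in>openings \<pi>. ?T (\<pi> a))"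
      using noncrossing_inj[OF n'] by (subst sum.reindex) auto
    ultimately show ?thesis by (simp add: total_spin_op_apply sum.distrib)
  qed
  then show ?thesis using matching_state_H_tot by (simp add: singlets_def fun_eq_iff)
qed

text \<open>The third total spin component is diagonal, with value \<open>L/2 - card U\<close> at
  \<open>cfg L U\<close>.\<close>

lemma singlet_balanced:
  assumes "\<psi> \<in> singlets L" "U \<subseteq> {1..L}" "\<psi> (cfg L U) \<noteq> 0"
  shows "2 * card U = L"
proof -
  have "spin_op 3 \<alpha> \<psi> (cfg L U) = (if \<alpha> \<in> U then - 1/2 else 1/2) * \<psi> (cfg L U)"
    if "\<alpha> \<in> {1..L}" for \<alpha>
  proof -
    have "cfg L U = (cfg L U)(\<alpha> := cfg L U \<alpha>)" by simp
    then show ?thesis using that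
      unfolding spin_op_def site_op_apply
      by (cases "\<alpha> \<in> U") (simp_all add: cfg_def spin_matrix_entries fun_upd_idem)
  qed
  then have "total_spin_op L 3 \<psi> (cfg L U) =
      (\<Sum>\<alpha>\<in>{1..L}. (if \<alpha> \<in> U then - 1/2 else 1/2)) * \<psi> (cfg L U)"
    unfolding total_spin_op_apply sum_distrib_right by (intro sum.cong) auto
  then have "(\<Sum>\<alpha>\<in>{1..L}. (if \<alpha> \<in> U then - 1/2 else 1/2 :: complex)) = 0"
    using assms by (simp add: singlets_def)
  moreover have "{1..L} \<inter> {\<alpha>. \<alpha> \<in> U} = U" "{1..L} \<inter> - {\<alpha>. \<alpha> \<in> U} = {1..L} - U"
    using assms(2) by auto
  ultimately have "of_nat (card ({1..L} - U)) = (of_nat (card U) :: complex)"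
    by (simp add: sum.If_cases)
  then have "card ({1..L} - U) = card U" by (simp only: of_nat_eq_iff)
  moreover have "card ({1..L} - U) + card U = L"
    using assms(2) card_Diff_subset[of U "{1..L}"] card_mono[OF _ assms(2)] finite_subset[OF assms(2)]
    by simp
  ultimately show ?thesis by simp
qed

text \<open>The raising operator annihilates a singlet; evaluated at \<open>cfg L T\<close> it
  collects the amplitudes of the configurations with one more down spin.\<close>

lemma singlet_harmonic:
  assumes "\<psi> \<in> singlets L" "T \<subseteq> {1..L}"
  shows "(\<Sum>x\<in>{1..L} - T. \<psi> (cfg L (insert x T))) = 0"
proof -
  have "spin_op 1 \<alpha> \<psi> (cfg L T) + \<i> * spin_op 2 \<alpha> \<psi> (cfg L T) =
      (if \<alpha> \<in> {1..L} - T then \<psi> (cfg L (insert \<alpha> T)) else 0)" if "\<alpha> \<in> {1..L}" for \<alpha>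
    using that unfolding spin_op_def site_op_apply cfg_upd[OF that]
    by (cases "\<alpha> \<in> T") (simp_all add: cfg_def spin_matrix_entries field_simps)
  then have "total_spin_op L 1 \<psi> (cfg L T) + \<i> * total_spin_op L 2 \<psi> (cfg L T) =
      (\<Sum>\<alpha>\<in>{1..L}. if \<alpha> \<in> {1..L} - T then \<psi> (cfg L (insert \<alpha> T)) else 0)"
    unfolding total_spin_op_apply sum_distrib_left sum.distrib[symmetric] by (intro sum.cong) auto
  also have "\<dots> = (\<Sum>x\<in>{1..L} - T. \<psi> (cfg L (insert x T)))"
    by (subst sum.inter_restrict[symmetric]) (auto intro!: sum.cong)
  finally show ?thesis using assms by (simp add: singlets_def)
qed

section \<open>Harmonic functions on the subsets of a finite set\<close>

text \<open>Downward induction on the size of \<open>A\<close>. Adding up the superset sums of all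
  sets \<open>insert x A\<close> counts each \<open>U\<close> of size \<open>k\<close> exactly
  \<open>k - card A\<close> times, a nonzero factor. For \<open>card A = k - 1\<close> each of these
  sums has one possibly nonzero term, and harmonicity at \<open>A\<close> applies.\<close>

lemma harmonic_superset_sum:
  fixes f :: "nat set \<Rightarrow> complex"
  assumes "finite X" and size: "\<And>U. U \<subseteq> X \<Longrightarrow> f U \<noteq> 0 \<Longrightarrow> card U = k"
    and harm: "\<And>T. T \<subseteq> X \<Longrightarrow> (\<Sum>x\<in>X - T. f (insert x T)) = 0"
    and A: "A \<subseteq> X" "card A < k"
  shows "(\<Sum>U | U \<subseteq> X \<and> A \<subseteq> U. f U) = 0"
  using A
proof (induction "k - card A" arbitrary: A rule: less_induct)
  case less
  have finA: "finite A" using less.prems \<open>finite X\<close> finite_subset by blast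
  have inner: "(\<Sum>x\<in>X - A. \<Sum>U | U \<subseteq> X \<and> insert x A \<subseteq> U. f U) = 0"
  proof (cases "Suc (card A) = k")
    case True
    have "(\<Sum>U | U \<subseteq> X \<and> insert x A \<subseteq> U. f U) = f (insert x A)" if x: "x \<in> X - A" for x
    proof -
      have "f U = 0" if U: "U \<subseteq> X \<and> insert x A \<subseteq> U" "U \<noteq> insert x A" for U
      proof (rule ccontr)
        assume "f U \<noteq> 0"
        then have "card U = card (insert x A)" using size U x finA True by simp
        moreover have "finite U" using U \<open>finite X\<close> finite_subset by blast
        ultimately show False using U card_subset_eq[of U "insert x A"] by simp
      qed
      then have "(\<Sum>U | U \<subseteq> X \<and> insert x A \<subseteq> U. f U) = (\<Sum>U\<in>{insert x A}. f U)"
        using x less.prems \<open>finite X\<close> by (intro sum.mono_neutral_right) auto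
      then show ?thesis by simp
    qed
    then show ?thesis using harm[OF less.prems(1)] by simp
  next
    case False
    have "(\<Sum>U | U \<subseteq> X \<and> insert x A \<subseteq> U. f U) = 0" if x: "x \<in> X - A" for x
      using x less.prems finA False by (intro less.hyps) auto
    then show ?thesis by simp
  qed
  have "(\<Sum>x\<in>X - A. \<Sum>U | U \<subseteq> X \<and> insert x A \<subseteq> U. f U) =
      (\<Sum>x\<in>X - A. \<Sum>U | U \<subseteq> X \<and> A \<subseteq> U. if x \<in> U then f U else 0)"
    using \<open>finite X\<close> by (intro sum.cong refl sum.mono_neutral_cong_left) auto
  also have "\<dots> = (\<Sum>U | U \<subseteq> X \<and> A \<subseteq> U. \<Sum>x\<in>X - A. if x \<in> U then f U else 0)"
    by (rule sum.swap)
  also have "\<dots> = (\<Sum>U | U \<subseteq> X \<and> A \<subseteq> U. of_nat (k - card A) * f U)"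
  proof (intro sum.cong refl)
    fix U assume "U \<in> {U. U \<subseteq> X \<and> A \<subseteq> U}"
    then have U: "U \<subseteq> X" "A \<subseteq> U" by auto
    have "(\<Sum>x\<in>X - A. if x \<in> U then f U else 0) = (\<Sum>x\<in>U - A. f U)"
      using U \<open>finite X\<close> by (intro sum.mono_neutral_cong_right) auto
    also have "\<dots> = of_nat (card U - card A) * f U"
      using card_Diff_subset[OF finA U(2)] by simp
    also have "\<dots> = of_nat (k - card A) * f U" using size[OF U(1)] by (cases "f U = 0") auto
    finally show "(\<Sum>x\<in>X - A. if x \<in> U then f U else 0) = of_nat (k - card A) * f U" .
  qed
  also have "\<dots> = of_nat (k - card A) * (\<Sum>U | U \<subseteq> X \<and> A \<subseteq> U. f U)"
    by (simp add: sum_distrib_left)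
  finally show ?case using inner less.prems(2) by simp
qed

text \<open>Inclusion-exclusion one element at a time: the sets avoiding \<open>E\<close> either
  avoid \<open>e\<close> or contain it. Moving \<open>e\<close> from the avoided to the required
  elements does not increase the total size bounded by \<open>k\<close>.\<close>

lemma harmonic_superset_avoiding_sum:
  fixes f :: "nat set \<Rightarrow> complex"
  assumes "finite X" and size: "\<And>U. U \<subseteq> X \<Longrightarrow> f U \<noteq> 0 \<Longrightarrow> card U = k"
    and harm: "\<And>T. T \<subseteq> X \<Longrightarrow> (\<Sum>x\<in>X - T. f (insert x T)) = 0"
    and "finite E" "A \<subseteq> X" "E \<subseteq> X" "card A + card E < k"
  shows "(\<Sum>U | U \<subseteq> X \<and> A \<subseteq> U \<and> U \<inter> E = {}. f U) = 0"
  using assms(4-)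
proof (induction E arbitrary: A rule: finite_induct)
  case empty
  then show ?case using harmonic_superset_sum[OF assms(1-3)] by simp
next
  case (insert e E)
  let ?S = "\<lambda>A E. {U. U \<subseteq> X \<and> A \<subseteq> U \<and> U \<inter> E = {}}"
  have fin: "finite (?S A E)" for A E using \<open>finite X\<close> by simp
  have split: "?S A E = ?S A (insert e E) \<union> ?S (insert e A) E" by auto
  have disj: "?S A (insert e E) \<inter> ?S (insert e A) E = {}" by auto
  have "sum f (?S A E) = sum f (?S A (insert e E)) + sum f (?S (insert e A) E)"
    by (subst split) (rule sum.union_disjoint[OF fin fin disj])
  moreover have "sum f (?S A E) = 0"
    by (rule insert.IH) (use insert.prems insert.hyps in auto)
  moreover have "sum f (?S (insert e A) E) = 0"
  proof (rule insert.IH)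
    have "finite A" using insert.prems(1) \<open>finite X\<close> finite_subset by blast
    then have "card (insert e A) \<le> Suc (card A)" by (simp add: card_insert_if)
    then show "card (insert e A) + card E < k" using insert.prems(3) insert.hyps by simp
  qed (use insert.prems in auto)
  ultimately show ?case by simp
qed

text \<open>The sum over the sets containing the elements of \<open>U\<close> up to \<open>p\<close> and avoiding the
  non-elements beyond \<open>p\<close> expresses \<open>f U\<close> through sets of smaller element sum.\<close>

lemma harmonic_vanishes_off_ballot:
  fixes f :: "nat set \<Rightarrow> complex"
  assumes "finite X" and size: "\<And>U. U \<subseteq> X \<Longrightarrow> f U \<noteq> 0 \<Longrightarrow> 2 * card U = card X"
    and harm: "\<And>T. T \<subseteq> X \<Longrightarrow> (\<Sum>x\<in>X - T. f (insert x T)) = 0"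
    and U: "U \<subseteq> X" and small: "\<And>W. W \<subseteq> X \<Longrightarrow> \<Sum>W < \<Sum>U \<Longrightarrow> f W = 0"
    and p: "card {x \<in> U. x \<le> p} < card {x \<in> X - U. x \<le> p}"
  shows "f U = 0"
proof (rule ccontr)
  assume nz: "f U \<noteq> 0"
  let ?A = "{x \<in> U. x \<le> p}" and ?E = "{x \<in> X - U. p < x}"
  have fin: "finite U" using U \<open>finite X\<close> finite_subset by blast
  have cU: "2 * card U = card X" using size U nz by blast
  have "card (X - U) = card U"
    using cU card_Diff_subset[OF fin U] by simp
  moreover have "card (X - U) = card {x \<in> X - U. x \<le> p} + card ?E"
    using \<open>finite X\<close> by (subst card_Un_disjoint[symmetric]) (auto intro!: arg_cong[where f = card])
  \<comment> \<open>As \<open>U\<close> is half of \<open>X\<close>, the failure of the ballot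
    condition at \<open>p\<close> is precisely this inequality.\<close>
  ultimately have lt: "card ?A + card ?E < card U" using p by simp
  have size': "card W = card U" if "W \<subseteq> X" "f W \<noteq> 0" for W using size[OF that] cU by simp
  have sum0: "(\<Sum>W | W \<subseteq> X \<and> ?A \<subseteq> W \<and> W \<inter> ?E = {}. f W) = 0"
    using lt U \<open>finite X\<close> by (intro harmonic_superset_avoiding_sum[OF \<open>finite X\<close> size' harm]) auto
  \<comment> \<open>Such a \<open>W\<close> arises from \<open>U\<close> by trading elements beyond
    \<open>p\<close> for equally many elements up to \<open>p\<close>, so its element sum is
    smaller.\<close>
  have "f W = 0" if W: "W \<subseteq> X" "?A \<subseteq> W" "W \<inter> ?E = {}" "W \<noteq> U" for W
  proof (rule ccontr)
    assume nzW: "f W \<noteq> 0"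
    have finW: "finite W" using W \<open>finite X\<close> finite_subset by blast
    have cW: "card W = card U" using size' W(1) nzW by blast
    have eq: "card (W - U) = card (U - W)"
      using card_Diff_subset_Int[of W U] card_Diff_subset_Int[of U W] finW fin cW
      by (simp add: Int_commute)
    have "W - U \<noteq> {}" using W(4) cW fin card_subset_eq[of U W] by auto
    then have pos: "card (W - U) > 0" using finW by (simp add: card_gt_0_iff)
    have "\<Sum>(W - U) \<le> card (W - U) * p"
      using sum_bounded_above[of "W - U" "\<lambda>x. x" p] W by force
    also have "\<dots> < card (U - W) * Suc p" using eq pos by simp
    also have "\<dots> \<le> \<Sum>(U - W)"
      using sum_bounded_below[of "U - W" "Suc p" "\<lambda>x. x"] W by force
    finally have "\<Sum>(W - U) < \<Sum>(U - W)" .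
    moreover have "\<Sum>W = \<Sum>(W \<inter> U) + \<Sum>(W - U)" "\<Sum>U = \<Sum>(U \<inter> W) + \<Sum>(U - W)"
      using sum.Int_Diff[OF finW, of "\<lambda>x. x" U] sum.Int_Diff[OF fin, of "\<lambda>x. x" W] by auto
    ultimately have "\<Sum>W < \<Sum>U" by (simp add: Int_commute)
    then show False using small W(1) nzW by blast
  qed
  then have "(\<Sum>W | W \<subseteq> X \<and> ?A \<subseteq> W \<and> W \<inter> ?E = {}. f W) = (\<Sum>W\<in>{U}. f W)"
    using U \<open>finite X\<close> by (intro sum.mono_neutral_right) auto
  then show False using sum0 nz by simp
qed

text \<open>Amplitudes are eliminated level by level in the element sum \<open>s\<close>. The
  matchings with opening sum \<open>s\<close> do not disturb lower levels, and at level
  \<open>s\<close> each of them is visible only at its own opening set.\<close>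

theorem matching_states_span:
  assumes "\<psi> \<in> singlets L"
  shows "\<exists>x. \<psi> = (\<lambda>\<sigma>. \<Sum>\<pi>\<in>ring_matchings L. x \<pi> * matching_state L \<pi> \<sigma>)"
proof -
  have "\<exists>x. \<psi> = (\<lambda>\<sigma>. \<Sum>\<pi>\<in>ring_matchings L. x \<pi> * matching_state L \<pi> \<sigma>)"
    if "\<psi> \<in> singlets L" "\<And>U. U \<subseteq> {1..L} \<Longrightarrow> \<Sum>U < s \<Longrightarrow> \<psi> (cfg L U) = 0" for s \<psi>
    using that
  proof (induction "Suc (\<Sum>{1..L}) - s" arbitrary: s \<psi> rule: less_induct)
    case less
    show ?case
    proof (cases "s \<le> \<Sum>{1..L}")
      case False
      have "\<psi> (cfg L U) = 0" if "U \<subseteq> {1..L}" for U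
        using sum_mono2[of "{1..L}" U "\<lambda>x. x"] that False by (intro less.prems(2)) auto
      then have "\<psi> = 0" using less.prems(1) by (intro state_eq_zeroI) (auto simp: singlets_def)
      then show ?thesis by (intro exI[of _ "\<lambda>_. 0"]) (simp add: fun_eq_iff)
    next
      case True
      let ?M = "{\<pi> \<in> ring_matchings L. \<Sum>(openings \<pi>) = s}"
      define x where "x \<pi> = \<psi> (cfg L (openings \<pi>)) / matching_state L \<pi> (cfg L (openings \<pi>))" for \<pi>
      define \<phi> where "\<phi> \<sigma> = \<psi> \<sigma> - (\<Sum>\<pi>\<in>?M. x \<pi> * matching_state L \<pi> \<sigma>)" for \<sigma>
      have \<phi>: "\<phi> \<in> singlets L" unfolding \<phi>_def[abs_def]
        using less.prems(1) matching_state_singlet by (intro singlets_diff_sum) auto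
      have finM: "finite ?M" using finite_ring_matchings by simp
      have low: "\<phi> (cfg L U) = 0" if U: "U \<subseteq> {1..L}" "\<Sum>U < s" for U
      proof -
        have "matching_state L \<pi> (cfg L U) = 0" if "\<pi> \<in> ?M" for \<pi>
          using matching_state_cfg_nonzero(1)[of \<pi> L U] that U by force
        then show ?thesis using less.prems(2)[OF U] by (simp add: \<phi>_def)
      qed
      \<comment> \<open>A set with nonzero amplitude would satisfy the ballot condition and thus be
        the opening set of a matching, but there the coefficient \<open>x\<close> was chosen to
        cancel the amplitude.\<close>
      have eq: "\<phi> (cfg L U) = 0" if U: "U \<subseteq> {1..L}" "\<Sum>U = s" for U
      proof (rule ccontr)
        assume nz: "\<phi> (cfg L U) \<noteq> 0"
        have cU: "2 * card U = L" using singlet_balanced[OF \<phi> U(1) nz] .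
        have finU: "finite U" using U finite_subset by blast
        have "card {x \<in> {1..L} - U. x \<le> p} \<le> card {x \<in> U. x \<le> p}" for p
        proof (rule ccontr)
          assume "\<not> ?thesis"
          then have "\<phi> (cfg L U) = 0"
            using singlet_balanced[OF \<phi>] singlet_harmonic[OF \<phi>] low U
            by (intro harmonic_vanishes_off_ballot[of "{1..L}" "\<lambda>U. \<phi> (cfg L U)" U p]) auto
          then show False using nz by contradiction
        qed
        moreover have "card ({1..L} - U) = card U"
          using card_Diff_subset[OF finU U(1)] cU by simp
        ultimately obtain \<pi> where \<pi>: "noncrossing {1..L} \<pi>" "openings \<pi> = U"
          using noncrossing_exists[of "{1..L}" U] U by auto
        then have \<pi>M: "\<pi> \<in> ?M" using U by (simp add: ring_matchings_def)
        have "matching_state L \<rho> (cfg L U) = 0" if \<rho>: "\<rho> \<in> ?M - {\<pi>}" for \<rho>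
        proof (rule ccontr)
          assume "matching_state L \<rho> (cfg L U) \<noteq> 0"
          then have "U = openings \<rho>" using matching_state_cfg_nonzero(2)[of \<rho> L U] \<rho> U by auto
          then show False using \<rho> \<pi> noncrossing_eqI[of "{1..L}" \<rho> \<pi>] by (auto simp: ring_matchings_def)
        qed
        then have "(\<Sum>\<rho>\<in>?M - {\<pi>}. x \<rho> * matching_state L \<rho> (cfg L U)) = 0"
          by (intro sum.neutral ballI) auto
        then have "(\<Sum>\<rho>\<in>?M. x \<rho> * matching_state L \<rho> (cfg L U)) = x \<pi> * matching_state L \<pi> (cfg L U)"
          using sum.remove[OF finM \<pi>M, of "\<lambda>\<rho>. x \<rho> * matching_state L \<rho> (cfg L U)"] by simp
        also have "\<dots> = \<psi> (cfg L U)"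
          using matching_state_openings[of \<pi> L] \<pi> \<pi>M by (simp add: x_def)
        finally show False using nz by (simp add: \<phi>_def)
      qed
      have "\<exists>y. \<phi> = (\<lambda>\<sigma>. \<Sum>\<pi>\<in>ring_matchings L. y \<pi> * matching_state L \<pi> \<sigma>)"
        using True low eq \<phi> by (intro less.hyps[of "Suc s"]) (auto simp: less_Suc_eq)
      then obtain y where y: "\<phi> = (\<lambda>\<sigma>. \<Sum>\<pi>\<in>ring_matchings L. y \<pi> * matching_state L \<pi> \<sigma>)" ..
      have "\<psi> \<sigma> = (\<Sum>\<pi>\<in>ring_matchings L. (y \<pi> + (if \<pi> \<in> ?M then x \<pi> else 0)) * matching_state L \<pi> \<sigma>)" for \<sigma>
      proof -
        have "(\<Sum>\<pi>\<in>?M. x \<pi> * matching_state L \<pi> \<sigma>) =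
          (\<Sum>\<pi>\<in>ring_matchings L. (if \<pi> \<in> ?M then x \<pi> else 0) * matching_state L \<pi> \<sigma>)"
          using finite_ring_matchings by (intro sum.mono_neutral_cong_left) auto
        moreover have "\<psi> \<sigma> = \<phi> \<sigma> + (\<Sum>\<pi>\<in>?M. x \<pi> * matching_state L \<pi> \<sigma>)" by (simp add: \<phi>_def)
        ultimately show ?thesis
          unfolding distrib_right sum.distrib by (simp only: fun_cong[OF y])
      qed
      then show ?thesis
        by (intro exI[of _ "\<lambda>\<pi>. y \<pi> + (if \<pi> \<in> ?M then x \<pi> else 0)"]) (rule ext)
    qed
  qed
  from this[OF assms, of 0] show ?thesis by simp
qed

section \<open>The Hamiltonian on matching states\<close>

text \<open>The coefficient of \<rho> in the image of \<pi> under \<open>gap_op\<close>. Bonds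
  contained in \<pi> contribute 0, and several bonds may lead to the same \<rho>.\<close>

definition transfer :: "nat \<Rightarrow> (nat \<Rightarrow> nat) \<Rightarrow> (nat \<Rightarrow> nat) \<Rightarrow> real"
  where "transfer L \<rho> \<pi> = (\<Sum>\<alpha>\<in>{1..L}. if \<pi> (bond_lo L \<alpha>) = bond_hi L \<alpha> then 0
    else of_bool (\<rho> = \<pi>) + of_bool (\<rho> = join (bond_lo L \<alpha>) (bond_hi L \<alpha>) \<pi>) / 2)"

definition gap_op :: "nat \<Rightarrow> state \<Rightarrow> state"
  where "gap_op L \<psi> = (\<lambda>\<sigma>. of_nat L * \<psi> \<sigma> - H_FM L \<psi> \<sigma>)"

lemma gap_op_apply:
  assumes "2 \<le> L"
  shows "gap_op L \<psi> \<sigma> =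
    (\<Sum>\<alpha>\<in>{1..L}. (\<psi> \<sigma> + \<psi> (exchange (bond_lo L \<alpha>) (bond_hi L \<alpha>) \<sigma>)) / 2)"
proof -
  have "gap_op L \<psi> \<sigma> = (\<Sum>\<alpha>\<in>{1..L}. \<psi> \<sigma> - bond (bond_lo L \<alpha>) (bond_hi L \<alpha>) \<psi> \<sigma>)"
    by (simp add: gap_op_def H_FM_eq_bonds[OF assms] sum_state_apply sum_subtractf)
  also have "\<dots> = (\<Sum>\<alpha>\<in>{1..L}. (\<psi> \<sigma> + \<psi> (exchange (bond_lo L \<alpha>) (bond_hi L \<alpha>) \<sigma>)) / 2)"
    by (intro sum.cong) (auto simp: bond_def field_simps)
  finally show ?thesis .
qed

lemma join_ring_matchings:
  "2 \<le> L \<Longrightarrow> \<pi> \<in> ring_matchings L \<Longrightarrow> \<alpha> \<in> {1..L} \<Longrightarrow>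
    join (bond_lo L \<alpha>) (bond_hi L \<alpha>) \<pi> \<in> ring_matchings L"
  using noncrossing_join adjacent_bond by (auto simp: ring_matchings_def)

lemma gap_op_matching_state:
  assumes L: "2 \<le> L" and n: "\<pi> \<in> ring_matchings L"
  shows "gap_op L (matching_state L \<pi>) \<sigma> =
    (\<Sum>\<rho>\<in>ring_matchings L. of_real (transfer L \<rho> \<pi>) * matching_state L \<rho> \<sigma>)"
proof -
  let ?M = "ring_matchings L" and ?j = "\<lambda>\<alpha>. join (bond_lo L \<alpha>) (bond_hi L \<alpha>) \<pi>"
    and ?\<Phi> = "\<lambda>\<rho>. matching_state L \<rho> \<sigma>" and ?c = "\<lambda>\<alpha>. \<pi> (bond_lo L \<alpha>) = bond_hi L \<alpha>"
  have pick: "(\<Sum>\<rho>\<in>?M. of_bool (\<rho> = \<rho>') * ?\<Phi> \<rho>) = ?\<Phi> \<rho>'" if "\<rho>' \<in> ?M" for \<rho>'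
  proof -
    have "(\<Sum>\<rho>\<in>?M. of_bool (\<rho> = \<rho>') * ?\<Phi> \<rho>) = (\<Sum>\<rho>\<in>?M. if \<rho> = \<rho>' then ?\<Phi> \<rho> else 0)"
      by (intro sum.cong) auto
    then show ?thesis using that finite_ring_matchings by simp
  qed
  have "gap_op L (matching_state L \<pi>) \<sigma> =
      (\<Sum>\<alpha>\<in>{1..L}. ?\<Phi> \<pi> - bond (bond_lo L \<alpha>) (bond_hi L \<alpha>) (matching_state L \<pi>) \<sigma>)"
    by (simp add: gap_op_def H_FM_eq_bonds[OF L] sum_state_apply sum_subtractf)
  also have "\<dots> = (\<Sum>\<alpha>\<in>{1..L}. if ?c \<alpha> then 0 else ?\<Phi> \<pi> + ?\<Phi> (?j \<alpha>) / 2)"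
  proof (intro sum.cong refl)
    fix \<alpha> assume "\<alpha> \<in> {1..L}"
    from adjacent_bond[OF L this] have adj: "adjacent {1..L} (bond_lo L \<alpha>) (bond_hi L \<alpha>)" .
    then have "bond_lo L \<alpha> \<in> {1..L}" "bond_lo L \<alpha> < bond_hi L \<alpha>" by (auto simp: adjacent_def)
    then show "?\<Phi> \<pi> - bond (bond_lo L \<alpha>) (bond_hi L \<alpha>) (matching_state L \<pi>) \<sigma> =
        (if ?c \<alpha> then 0 else ?\<Phi> \<pi> + ?\<Phi> (?j \<alpha>) / 2)"
      using bond_joined[OF n] bond_matching_state[OF n adj] by (simp add: scale_state_def)
  qed
  also have "\<dots> = (\<Sum>\<alpha>\<in>{1..L}. \<Sum>\<rho>\<in>?M. (if ?c \<alpha> then 0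
      else of_bool (\<rho> = \<pi>) + of_bool (\<rho> = ?j \<alpha>) / 2) * ?\<Phi> \<rho>)"
  proof (intro sum.cong refl)
    fix \<alpha> assume \<alpha>: "\<alpha> \<in> {1..L}"
    have "(\<Sum>\<rho>\<in>?M. (of_bool (\<rho> = \<pi>) + of_bool (\<rho> = ?j \<alpha>) / 2) * ?\<Phi> \<rho>) =
        (\<Sum>\<rho>\<in>?M. of_bool (\<rho> = \<pi>) * ?\<Phi> \<rho>) + (\<Sum>\<rho>\<in>?M. of_bool (\<rho> = ?j \<alpha>) * ?\<Phi> \<rho>) / 2"
      unfolding sum_divide_distrib sum.distrib[symmetric]
      by (intro sum.cong refl) (simp only: distrib_right times_divide_eq_left)
    also have "\<dots> = ?\<Phi> \<pi> + ?\<Phi> (?j \<alpha>) / 2"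
      using pick[OF n] pick[OF join_ring_matchings[OF L n \<alpha>]] by (simp only:)
    finally show "(if ?c \<alpha> then 0 else ?\<Phi> \<pi> + ?\<Phi> (?j \<alpha>) / 2) =
        (\<Sum>\<rho>\<in>?M. (if ?c \<alpha> then 0 else of_bool (\<rho> = \<pi>) + of_bool (\<rho> = ?j \<alpha>) / 2) * ?\<Phi> \<rho>)"
      by simp
  qed
  also have "\<dots> = (\<Sum>\<rho>\<in>?M. \<Sum>\<alpha>\<in>{1..L}. (if ?c \<alpha> then 0
      else of_bool (\<rho> = \<pi>) + of_bool (\<rho> = ?j \<alpha>) / 2) * ?\<Phi> \<rho>)"
    by (rule sum.swap)
  also have "\<dots> = (\<Sum>\<rho>\<in>?M. of_real (transfer L \<rho> \<pi>) * ?\<Phi> \<rho>)"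
    unfolding transfer_def of_real_sum sum_distrib_right
    by (intro sum.cong refl) auto
  finally show ?thesis .
qed

lemma gap_op_expansion:
  assumes L: "2 \<le> L"
    and \<psi>: "\<psi> = (\<lambda>\<sigma>. \<Sum>\<pi>\<in>ring_matchings L. x \<pi> * matching_state L \<pi> \<sigma>)"
  shows "gap_op L \<psi> = (\<lambda>\<sigma>. \<Sum>\<rho>\<in>ring_matchings L.
    (\<Sum>\<pi>\<in>ring_matchings L. of_real (transfer L \<rho> \<pi>) * x \<pi>) * matching_state L \<rho> \<sigma>)"
proof
  fix \<sigma>
  let ?M = "ring_matchings L"
  have "gap_op L \<psi> \<sigma> = (\<Sum>\<pi>\<in>?M. x \<pi> * gap_op L (matching_state L \<pi>) \<sigma>)"
    unfolding gap_op_apply[OF L] \<psi> sum_distrib_left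
    by (subst sum.swap) (intro sum.cong refl, simp add: sum_divide_distrib sum.distrib[symmetric] distrib_left)
  also have "\<dots> = (\<Sum>\<pi>\<in>?M. \<Sum>\<rho>\<in>?M. of_real (transfer L \<rho> \<pi>) * x \<pi> * matching_state L \<rho> \<sigma>)"
    by (intro sum.cong refl) (simp add: gap_op_matching_state[OF L] sum_distrib_left mult_ac)
  also have "\<dots> = (\<Sum>\<rho>\<in>?M. (\<Sum>\<pi>\<in>?M. of_real (transfer L \<rho> \<pi>) * x \<pi>) * matching_state L \<rho> \<sigma>)"
    unfolding sum_distrib_right by (rule sum.swap)
  finally show "gap_op L \<psi> \<sigma> = \<dots>" .
qed

text \<open>By \<open>join_irreducible\<close> a proper nonempty set of matchings is left by some
  join of \<open>p\<close> and \<open>p + 1\<close>. That join changes the matching, so its bond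
  contributes a positive entry.\<close>

lemma transfer_irreducible:
  assumes "even L" "2 \<le> L"
  shows "nonneg_irreducible (ring_matchings L) (transfer L)"
proof
  show "finite (ring_matchings L)" by (rule finite_ring_matchings)
  show "ring_matchings L \<noteq> {}" using \<open>even L\<close> by (rule ring_matchings_nonempty)
  show "0 \<le> transfer L j i" for j i unfolding transfer_def by (intro sum_nonneg) auto
  fix S assume S: "S \<subseteq> ring_matchings L" "S \<noteq> {}" "S \<noteq> ring_matchings L"
  then obtain \<pi> p where \<pi>: "\<pi> \<in> S" "1 \<le> p" "p < L" "join p (Suc p) \<pi> \<notin> S"
    using join_irreducible[OF \<open>even L\<close> S(1,2)] by blast
  have n: "\<pi> \<in> ring_matchings L" using S \<pi> by blast
  have p: "bond_lo L p = p" "bond_hi L p = Suc p" "p \<in> {1..L}"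
    using \<pi> by (auto simp: bond_lo_def bond_hi_def)
  let ?\<rho> = "join p (Suc p) \<pi>"
  let ?t = "\<lambda>\<alpha>. if \<pi> (bond_lo L \<alpha>) = bond_hi L \<alpha> then 0
    else of_bool (?\<rho> = \<pi>) + of_bool (?\<rho> = join (bond_lo L \<alpha>) (bond_hi L \<alpha>) \<pi>) / (2 :: real)"
  have "?\<rho> \<noteq> \<pi>" using \<pi> by auto
  then have "\<pi> p \<noteq> Suc p" using join_joined[of "{1..L}" \<pi> p "Suc p"] n by (auto simp: ring_matchings_def)
  then have "?t p > 0" using p by simp
  also have "?t p \<le> transfer L ?\<rho> \<pi>"
    unfolding transfer_def using p(3) by (intro member_le_sum) auto
  finally have "transfer L ?\<rho> \<pi> > 0" .
  moreover have "?\<rho> \<in> ring_matchings L - S"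
    using join_ring_matchings[OF \<open>2 \<le> L\<close> n p(3)] \<pi>(4) p by simp
  ultimately show "\<exists>i\<in>S. \<exists>j\<in>ring_matchings L - S. 0 < transfer L j i" using \<pi>(1) by blast
qed

text \<open>Each exchange is an involution permuting the configurations of the ring.\<close>

lemma gap_op_hermitian:
  assumes L: "2 \<le> L"
  shows "inner_state L \<phi> (gap_op L \<psi>) = inner_state L (gap_op L \<phi>) \<psi>"
proof -
  let ?e = "\<lambda>\<alpha>. exchange (bond_lo L \<alpha>) (bond_hi L \<alpha>)"
  have swap: "(\<Sum>\<sigma>\<in>configs L. cnj (\<phi> \<sigma>) * \<psi> (?e \<alpha> \<sigma>)) = (\<Sum>\<sigma>\<in>configs L. cnj (\<phi> (?e \<alpha> \<sigma>)) * \<psi> \<sigma>)"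
    if "\<alpha> \<in> {1..L}" for \<alpha>
  proof -
    have "bond_lo L \<alpha> \<in> {1..L}" "bond_hi L \<alpha> \<in> {1..L}"
      using adjacent_bond[OF L that] by (auto simp: adjacent_def)
    then show ?thesis
      by (intro sum.reindex_bij_witness[where i = "?e \<alpha>" and j = "?e \<alpha>"])
        (simp_all add: exchange_configs del: atLeastAtMost_iff)
  qed
  have "(\<Sum>\<alpha>\<in>{1..L}. \<Sum>\<sigma>\<in>configs L. cnj (\<phi> \<sigma>) * ((\<psi> \<sigma> + \<psi> (?e \<alpha> \<sigma>)) / 2)) =
    (\<Sum>\<alpha>\<in>{1..L}. \<Sum>\<sigma>\<in>configs L. cnj ((\<phi> \<sigma> + \<phi> (?e \<alpha> \<sigma>)) / 2) * \<psi> \<sigma>)"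
  proof (rule sum.cong[OF refl])
    fix \<alpha> assume \<alpha>: "\<alpha> \<in> {1..L}"
    have "(\<Sum>\<sigma>\<in>configs L. cnj (\<phi> \<sigma>) * ((\<psi> \<sigma> + \<psi> (?e \<alpha> \<sigma>)) / 2)) =
        ((\<Sum>\<sigma>\<in>configs L. cnj (\<phi> \<sigma>) * \<psi> \<sigma>) + (\<Sum>\<sigma>\<in>configs L. cnj (\<phi> \<sigma>) * \<psi> (?e \<alpha> \<sigma>))) / 2"
      by (simp add: distrib_left sum.distrib flip: sum_divide_distrib)
    also have "\<dots> = (\<Sum>\<sigma>\<in>configs L. cnj ((\<phi> \<sigma> + \<phi> (?e \<alpha> \<sigma>)) / 2) * \<psi> \<sigma>)"
      unfolding swap[OF \<alpha>] by (simp add: distrib_right sum.distrib flip: sum_divide_distrib)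
    finally show "(\<Sum>\<sigma>\<in>configs L. cnj (\<phi> \<sigma>) * ((\<psi> \<sigma> + \<psi> (?e \<alpha> \<sigma>)) / 2)) =
        (\<Sum>\<sigma>\<in>configs L. cnj ((\<phi> \<sigma> + \<phi> (?e \<alpha> \<sigma>)) / 2) * \<psi> \<sigma>)" .
  qed
  moreover have "inner_state L \<phi> (gap_op L \<psi>) =
      (\<Sum>\<alpha>\<in>{1..L}. \<Sum>\<sigma>\<in>configs L. cnj (\<phi> \<sigma>) * ((\<psi> \<sigma> + \<psi> (?e \<alpha> \<sigma>)) / 2))"
    unfolding inner_state_def gap_op_apply[OF L] sum_distrib_left by (rule sum.swap)
  moreover have "inner_state L (gap_op L \<phi>) \<psi> =
      (\<Sum>\<alpha>\<in>{1..L}. \<Sum>\<sigma>\<in>configs L. cnj ((\<phi> \<sigma> + \<phi> (?e \<alpha> \<sigma>)) / 2) * \<psi> \<sigma>)"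
    unfolding inner_state_def gap_op_apply[OF L] cnj_sum sum_distrib_right by (rule sum.swap)
  ultimately show ?thesis by simp
qed

section \<open>The bottom of the spectrum\<close>

lemma inner_state_Cauchy_Schwarz: "cmod (inner_state L \<phi> \<psi>) \<le> norm_state L \<phi> * norm_state L \<psi>"
proof -
  have "cmod (inner_state L \<phi> \<psi>) \<le> (\<Sum>\<sigma>\<in>configs L. \<bar>cmod (\<phi> \<sigma>)\<bar> * \<bar>cmod (\<psi> \<sigma>)\<bar>)"
    unfolding inner_state_def by (rule order_trans[OF norm_sum]) (simp add: norm_mult)
  also have "\<dots> \<le> norm_state L \<phi> * norm_state L \<psi>"
    using L2_set_mult_ineq[of "\<lambda>\<sigma>. cmod (\<phi> \<sigma>)" "\<lambda>\<sigma>. cmod (\<psi> \<sigma>)" "configs L"]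
    by (simp add: norm_state_def L2_set_def)
  finally show ?thesis .
qed

lemma norm_state_nonneg: "0 \<le> norm_state L \<psi>"
  by (simp add: norm_state_def sum_nonneg)

text \<open>Log-convexity makes the successive ratios nondecreasing, so the sequence grows at least
  like powers of \<open>a 1 / a 0\<close>; a first ratio above \<rho> would contradict the
  bound.\<close>

lemma log_convex_growth:
  fixes a :: "nat \<Rightarrow> real"
  assumes nonneg: "\<And>n. 0 \<le> a n" and conv: "\<And>n. (a (Suc n))\<^sup>2 \<le> a n * a (Suc (Suc n))"
    and bound: "\<And>n. a n \<le> C * \<rho> ^ n" and "0 \<le> \<rho>"
  shows "a 1 \<le> \<rho> * a 0"
proof (rule ccontr)
  assume "\<not> ?thesis"
  then have gt: "\<rho> * a 0 < a 1" by simp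
  have "a 0 \<noteq> 0" using conv[of 0] gt by auto
  then have a0: "0 < a 0" using nonneg[of 0] by simp
  define r where "r = a 1 / a 0"
  have r: "\<rho> < r" using gt a0 by (simp add: r_def pos_less_divide_eq)
  then have "0 < r" using \<open>0 \<le> \<rho>\<close> by simp
  have step: "0 < a n \<and> r * a n \<le> a (Suc n)" for n
  proof (induction n)
    case 0
    then show ?case using a0 by (simp add: r_def)
  next
    case (Suc n)
    then have pos: "0 < a (Suc n)" using \<open>0 < r\<close> by (meson less_le_trans mult_pos_pos)
    have "r * a n * a (Suc n) \<le> a (Suc n) * a (Suc n)" using Suc pos by (intro mult_right_mono) auto
    also have "\<dots> \<le> a n * a (Suc (Suc n))" using conv[of n] by (simp add: power2_eq_square)
    finally have "a n * (r * a (Suc n)) \<le> a n * a (Suc (Suc n))" by (simp add: mult_ac)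
    then show ?case using Suc pos by simp
  qed
  have low: "a 0 * r ^ n \<le> a n" for n
  proof (induction n)
    case (Suc n)
    have "a 0 * r ^ Suc n = r * (a 0 * r ^ n)" by simp
    also have "\<dots> \<le> r * a n" using Suc \<open>0 < r\<close> by (intro mult_left_mono) auto
    also have "\<dots> \<le> a (Suc n)" using step by blast
    finally show ?case .
  qed simp
  have "a 0 \<le> C * (\<rho> / r) ^ n" for n
  proof -
    have "a 0 * r ^ n \<le> C * \<rho> ^ n" using low bound order_trans by blast
    then show ?thesis using \<open>0 < r\<close> by (simp add: power_divide pos_le_divide_eq)
  qed
  moreover have "(\<lambda>n. C * (\<rho> / r) ^ n) \<longlonglongrightarrow> C * 0"
    using r \<open>0 < r\<close> \<open>0 \<le> \<rho>\<close> by (intro tendsto_mult tendsto_const LIMSEQ_realpow_zero) auto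
  ultimately have "a 0 \<le> C * 0" by (intro LIMSEQ_le_const) auto
  then show False using a0 by simp
qed

text \<open>Iteration turns a crude comparison into a sharp one: a coefficient bound by a multiple
  of \<open>v\<close> is multiplied by \<open>r\<close> at each step, so the iterates have norm at
  most a constant times \<open>r ^ n\<close>, and log-convexity removes the constant.\<close>

lemma gap_op_norm_le:
  assumes L: "2 \<le> L" and v: "\<forall>\<pi>\<in>ring_matchings L. 0 < v \<pi>"
    and eig: "\<forall>\<rho>\<in>ring_matchings L. (\<Sum>\<pi>\<in>ring_matchings L. transfer L \<rho> \<pi> * v \<pi>) = r * v \<rho>"
    and "0 \<le> r" and \<psi>: "\<psi> \<in> singlets L"
  shows "norm_state L (gap_op L \<psi>) \<le> r * norm_state L \<psi>"
proof -
  let ?M = "ring_matchings L"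
  let ?K = "\<lambda>n. (gap_op L ^^ n) \<psi>"
  obtain x where x: "\<psi> = (\<lambda>\<sigma>. \<Sum>\<pi>\<in>?M. x \<pi> * matching_state L \<pi> \<sigma>)"
    using matching_states_span[OF \<psi>] by blast
  define s where "s = (\<Sum>\<pi>\<in>?M. cmod (x \<pi>) / v \<pi>)"
  have s: "cmod (x \<pi>) \<le> s * v \<pi>" if "\<pi> \<in> ?M" for \<pi>
  proof -
    have "cmod (x \<pi>) / v \<pi> \<le> s" unfolding s_def
      using that v finite_ring_matchings by (intro member_le_sum) (auto simp: less_imp_le)
    then show ?thesis using v that by (simp add: pos_divide_le_eq)
  qed
  have iter: "\<exists>y. ?K n = (\<lambda>\<sigma>. \<Sum>\<pi>\<in>?M. y \<pi> * matching_state L \<pi> \<sigma>) \<and>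
      (\<forall>\<pi>\<in>?M. cmod (y \<pi>) \<le> s * r ^ n * v \<pi>)" for n
  proof (induction n)
    case 0
    then show ?case using x s by auto
  next
    case (Suc n)
    then obtain y where y: "?K n = (\<lambda>\<sigma>. \<Sum>\<pi>\<in>?M. y \<pi> * matching_state L \<pi> \<sigma>)"
      "\<forall>\<pi>\<in>?M. cmod (y \<pi>) \<le> s * r ^ n * v \<pi>" by blast
    let ?z = "\<lambda>\<rho>. \<Sum>\<pi>\<in>?M. of_real (transfer L \<rho> \<pi>) * y \<pi>"
    have "cmod (?z \<rho>) \<le> s * r ^ Suc n * v \<rho>" if "\<rho> \<in> ?M" for \<rho>
    proof -
      have pos: "0 \<le> transfer L \<rho> \<pi>" for \<pi> unfolding transfer_def by (intro sum_nonneg) auto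
      have "cmod (?z \<rho>) \<le> (\<Sum>\<pi>\<in>?M. transfer L \<rho> \<pi> * cmod (y \<pi>))"
        by (rule order_trans[OF norm_sum]) (simp add: norm_mult pos)
      also have "\<dots> \<le> (\<Sum>\<pi>\<in>?M. transfer L \<rho> \<pi> * (s * r ^ n * v \<pi>))"
        using y(2) pos by (intro sum_mono mult_left_mono) auto
      also have "\<dots> = s * r ^ n * (\<Sum>\<pi>\<in>?M. transfer L \<rho> \<pi> * v \<pi>)"
        by (simp add: sum_distrib_left mult_ac)
      also have "\<dots> = s * r ^ Suc n * v \<rho>" using eig that by simp
      finally show ?thesis .
    qed
    moreover have "?K (Suc n) = (\<lambda>\<sigma>. \<Sum>\<rho>\<in>?M. ?z \<rho> * matching_state L \<rho> \<sigma>)"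
      using gap_op_expansion[OF L y(1)] by simp
    ultimately show ?case by (intro exI[of _ ?z] conjI ballI)
  qed
  define D where "D \<sigma> = (\<Sum>\<pi>\<in>?M. s * v \<pi> * cmod (matching_state L \<pi> \<sigma>))" for \<sigma>
  have pt: "cmod (?K n \<sigma>) \<le> D \<sigma> * r ^ n" for n \<sigma>
  proof -
    obtain y where y: "?K n = (\<lambda>\<sigma>. \<Sum>\<pi>\<in>?M. y \<pi> * matching_state L \<pi> \<sigma>)"
      "\<forall>\<pi>\<in>?M. cmod (y \<pi>) \<le> s * r ^ n * v \<pi>" using iter by blast
    have "cmod (?K n \<sigma>) \<le> (\<Sum>\<pi>\<in>?M. cmod (y \<pi>) * cmod (matching_state L \<pi> \<sigma>))"
      unfolding y(1) by (rule order_trans[OF norm_sum]) (simp add: norm_mult)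
    also have "\<dots> \<le> (\<Sum>\<pi>\<in>?M. s * r ^ n * v \<pi> * cmod (matching_state L \<pi> \<sigma>))"
      using y(2) by (intro sum_mono mult_right_mono) auto
    also have "\<dots> = D \<sigma> * r ^ n" unfolding D_def sum_distrib_right by (intro sum.cong refl) (simp only: mult_ac)
    finally show ?thesis .
  qed
  have "norm_state L (?K n) \<le> (\<Sum>\<sigma>\<in>configs L. D \<sigma>) * r ^ n" for n
  proof -
    have "norm_state L (?K n) \<le> (\<Sum>\<sigma>\<in>configs L. cmod (?K n \<sigma>))"
      using L2_set_le_sum[of "configs L" "\<lambda>\<sigma>. cmod (?K n \<sigma>)"] by (simp add: norm_state_def L2_set_def)
    also have "\<dots> \<le> (\<Sum>\<sigma>\<in>configs L. D \<sigma> * r ^ n)" by (intro sum_mono pt)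
    finally show ?thesis by (simp add: sum_distrib_right)
  qed
  \<comment> \<open>Hermiticity moves one factor of \<open>gap_op\<close> across the inner product;
    then Cauchy-Schwarz applies.\<close>
  moreover have "(norm_state L (?K (Suc n)))\<^sup>2 \<le> norm_state L (?K n) * norm_state L (?K (Suc (Suc n)))" for n
  proof -
    have "inner_state L (?K (Suc n)) (?K (Suc n)) = inner_state L (?K n) (?K (Suc (Suc n)))"
      using gap_op_hermitian[OF L, of "?K n" "?K (Suc n)"] by simp
    then have "(norm_state L (?K (Suc n)))\<^sup>2 = cmod (inner_state L (?K n) (?K (Suc (Suc n))))"
      unfolding inner_state_self by (metis abs_of_nonneg norm_of_real zero_le_power2)
    then show ?thesis using inner_state_Cauchy_Schwarz by simp
  qed
  ultimately have "norm_state L (?K 1) \<le> r * norm_state L (?K 0)"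
    using norm_state_nonneg \<open>0 \<le> r\<close>
    by (intro log_convex_growth[of "\<lambda>n. norm_state L (?K n)"]) auto
  then show ?thesis by simp
qed

theorem lemma2p3:
  fixes L :: nat
  assumes "even L" and "L > 0"
  shows "\<exists>\<Theta>\<in>spin_sector L 0.
    (\<exists>c :: (nat \<times> nat) list \<Rightarrow> real.
       (\<forall>m\<in>noncrossing_matchings L. c m > 0) \<and>
       \<Theta> = (\<Sum>m\<in>noncrossing_matchings L. scale_state (of_real (c m)) (bracket_state L m))) \<and>
    H_FM L \<Theta> = scale_state (of_real (E_min_FM 0 L)) \<Theta> \<and>
    {\<psi> \<in> spin_sector L 0. H_FM L \<psi> = scale_state (of_real (E_min_FM 0 L)) \<psi>} = state.span {\<Theta>}"
proof -
  have L: "2 \<le> L" using assms by (auto elim!: evenE)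
  let ?M = "ring_matchings L"
  interpret nonneg_irreducible ?M "transfer L"
    using \<open>even L\<close> L by (rule transfer_irreducible)
  obtain r v where r: "0 \<le> r" and v: "\<forall>\<pi>\<in>?M. 0 < v \<pi>"
    and eig: "\<forall>\<rho>\<in>?M. app v \<rho> = r * v \<rho>"
    by (rule Perron_vector_exists)
  define \<Theta> where "\<Theta> = (\<lambda>\<sigma>. \<Sum>\<pi>\<in>?M. of_real (v \<pi>) * matching_state L \<pi> \<sigma>)"
  define E where "E = real L - r"
  have gap_iff: "gap_op L \<psi> = scale_state (of_real r) \<psi> \<longleftrightarrow> H_FM L \<psi> = scale_state (of_real E) \<psi>" for \<psi>
    by (auto simp: gap_op_def scale_state_def E_def fun_eq_iff algebra_simps)
  have "gap_op L \<Theta> = scale_state (of_real r) \<Theta>"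
  proof -
    have "gap_op L \<Theta> = (\<lambda>\<sigma>. \<Sum>\<rho>\<in>?M. of_real (app v \<rho>) * matching_state L \<rho> \<sigma>)"
      unfolding gap_op_expansion[OF L \<Theta>_def] app_def by simp
    then show ?thesis using eig
      by (simp add: \<Theta>_def scale_state_def sum_distrib_left mult_ac cong: sum.cong)
  qed
  then have H\<Theta>: "H_FM L \<Theta> = scale_state (of_real E) \<Theta>" by (simp only: gap_iff)
  have zero: "(0 :: state) \<in> singlets L"
    by (simp add: singlets_def H_tot_def fun_eq_iff total_spin_op_apply spin_op_def site_op_apply)
  have comb: "(\<lambda>\<sigma>. \<Sum>\<pi>\<in>?M. x \<pi> * matching_state L \<pi> \<sigma>) \<in> singlets L" for x
    using singlets_diff_sum[OF zero, of ?M "matching_state L" "\<lambda>\<pi>. - x \<pi>"] matching_state_singlet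
    by (simp add: sum_negf)
  have \<Theta>: "\<Theta> \<in> singlets L" unfolding \<Theta>_def by (rule comb)
  have "\<Theta> \<noteq> 0"
  proof
    assume "\<Theta> = 0"
    then have "(\<Sum>\<pi>\<in>?M. of_real (v \<pi>) * matching_state L \<pi> \<sigma>) = 0" for \<sigma>
      by (simp add: \<Theta>_def fun_eq_iff)
    from matching_states_independent[OF this] have "\<forall>\<pi>\<in>?M. v \<pi> = 0" by simp
    then show False using v I_nonempty by fastforce
  qed
  have norm_pos: "0 < norm_state L \<psi>" if "\<psi> \<in> singlets L" "\<psi> \<noteq> 0" for \<psi>
    using that norm_state_eq_0[of \<psi> L] norm_state_nonneg[of L \<psi>] by (auto simp: singlets_def less_le)
  have E_min: "E_min_FM 0 L = E"
    unfolding E_min_FM_def spin_sector_0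
  proof (rule Least_equality)
    have "inner_state L \<Theta> (H_FM L \<Theta>) = of_real E * inner_state L \<Theta> \<Theta>"
      unfolding H\<Theta> by (simp add: inner_state_def scale_state_def sum_distrib_left mult_ac)
    then have "Re (inner_state L \<Theta> (H_FM L \<Theta>)) / (norm_state L \<Theta>)\<^sup>2 = E"
      using norm_pos[OF \<Theta> \<open>\<Theta> \<noteq> 0\<close>] unfolding inner_state_self by simp
    then show "E \<in> {Re (inner_state L \<psi> (H_FM L \<psi>)) / (norm_state L \<psi>)\<^sup>2 | \<psi>.
        \<psi> \<in> singlets L \<and> \<psi> \<noteq> 0}" using \<Theta> \<open>\<Theta> \<noteq> 0\<close> by blast
  next
    fix e assume "e \<in> {Re (inner_state L \<psi> (H_FM L \<psi>)) / (norm_state L \<psi>)\<^sup>2 | \<psi>.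
        \<psi> \<in> singlets L \<and> \<psi> \<noteq> 0}"
    then obtain \<psi> where \<psi>: "\<psi> \<in> singlets L" "\<psi> \<noteq> 0"
      and e: "e = Re (inner_state L \<psi> (H_FM L \<psi>)) / (norm_state L \<psi>)\<^sup>2" by blast
    have "inner_state L \<psi> (H_FM L \<psi>) = of_nat L * inner_state L \<psi> \<psi> - inner_state L \<psi> (gap_op L \<psi>)"
      by (simp add: inner_state_def gap_op_def sum_distrib_left sum_subtractf[symmetric] algebra_simps)
    then have Re: "Re (inner_state L \<psi> (H_FM L \<psi>)) =
        real L * (norm_state L \<psi>)\<^sup>2 - Re (inner_state L \<psi> (gap_op L \<psi>))"
      unfolding inner_state_self by (simp flip: of_real_power)
    \<comment> \<open>An upper bound \<open>r\<close> for the Rayleigh quotients of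
      \<open>gap_op\<close> is the lower bound \<open>L - r\<close> for those of the
      Hamiltonian.\<close>
    have "Re (inner_state L \<psi> (gap_op L \<psi>)) \<le> norm_state L \<psi> * norm_state L (gap_op L \<psi>)"
      using complex_Re_le_cmod inner_state_Cauchy_Schwarz order_trans by blast
    also have "\<dots> \<le> norm_state L \<psi> * (r * norm_state L \<psi>)"
      using gap_op_norm_le[OF L v _ r \<psi>(1)] eig norm_state_nonneg
      by (intro mult_left_mono) (auto simp: app_def)
    finally have "E * (norm_state L \<psi>)\<^sup>2 \<le> Re (inner_state L \<psi> (H_FM L \<psi>))"
      unfolding Re E_def by (simp add: power2_eq_square algebra_simps)
    then show "E \<le> e" unfolding e using norm_pos[OF \<psi>] by (simp add: pos_le_divide_eq)
  qed
  have eigenspace: "{\<psi> \<in> singlets L. H_FM L \<psi> = scale_state (of_real E) \<psi>} = state.span {\<Theta>}"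
  proof
    show "state.span {\<Theta>} \<subseteq> {\<psi> \<in> singlets L. H_FM L \<psi> = scale_state (of_real E) \<psi>}"
    proof
      fix \<psi> assume "\<psi> \<in> state.span {\<Theta>}"
      then obtain k where k: "\<psi> = scale_state k \<Theta>" by (auto simp: state.span_singleton)
      have "\<psi> = (\<lambda>\<sigma>. \<Sum>\<pi>\<in>?M. (k * of_real (v \<pi>)) * matching_state L \<pi> \<sigma>)"
        unfolding k scale_state_def \<Theta>_def by (simp add: sum_distrib_left mult_ac)
      then have "\<psi> \<in> singlets L" using comb by metis
      moreover have "H_FM L \<psi> = scale_state k (H_FM L \<Theta>)"
        unfolding k H_FM_eq_bonds[OF L]
        by (simp add: fun_eq_iff sum_state_apply bond_def scale_state_def sum_distrib_left algebra_simps)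
      then have "H_FM L \<psi> = scale_state (of_real E) \<psi>"
        unfolding H\<Theta> k by (simp add: scale_state_def mult_ac)
      ultimately show "\<psi> \<in> {\<psi> \<in> singlets L. H_FM L \<psi> = scale_state (of_real E) \<psi>}" by blast
    qed
    show "{\<psi> \<in> singlets L. H_FM L \<psi> = scale_state (of_real E) \<psi>} \<subseteq> state.span {\<Theta>}"
    proof
      fix \<psi> assume "\<psi> \<in> {\<psi> \<in> singlets L. H_FM L \<psi> = scale_state (of_real E) \<psi>}"
      then have \<psi>: "\<psi> \<in> singlets L" "gap_op L \<psi> = scale_state (of_real r) \<psi>"
        unfolding gap_iff by auto
      obtain x where x: "\<psi> = (\<lambda>\<sigma>. \<Sum>\<pi>\<in>?M. x \<pi> * matching_state L \<pi> \<sigma>)"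
        using matching_states_span[OF \<psi>(1)] by blast
      let ?y = "\<lambda>\<rho>. \<Sum>\<pi>\<in>?M. of_real (transfer L \<rho> \<pi>) * x \<pi>"
      have "(\<Sum>\<rho>\<in>?M. (?y \<rho> - of_real r * x \<rho>) * matching_state L \<rho> \<sigma>) = 0" for \<sigma>
      proof -
        have "(\<Sum>\<rho>\<in>?M. ?y \<rho> * matching_state L \<rho> \<sigma>) = of_real r * \<psi> \<sigma>"
          using \<psi>(2) fun_cong[OF gap_op_expansion[OF L x], of \<sigma>] by (simp add: scale_state_def)
        also have "\<dots> = (\<Sum>\<rho>\<in>?M. of_real r * x \<rho> * matching_state L \<rho> \<sigma>)"
          unfolding x by (simp add: sum_distrib_left mult.assoc)
        finally show ?thesis by (simp add: left_diff_distrib sum_subtractf)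
      qed
      from matching_states_independent[OF this]
      have y: "?y \<rho> = of_real r * x \<rho>" if "\<rho> \<in> ?M" for \<rho> using that by simp
      \<comment> \<open>The matrix is real, so the real and imaginary parts of the complex
        coefficients solve the eigenvalue equation separately; each is a real multiple of
        \<open>v\<close>.\<close>
      have "app (\<lambda>\<pi>. Re (x \<pi>)) \<rho> = r * Re (x \<rho>)" "app (\<lambda>\<pi>. Im (x \<pi>)) \<rho> = r * Im (x \<rho>)"
        if "\<rho> \<in> ?M" for \<rho>
        using arg_cong[OF y[OF that], of Re] arg_cong[OF y[OF that], of Im] by (simp_all add: app_def)
      then obtain t u where tu: "\<forall>\<pi>\<in>?M. Re (x \<pi>) = t * v \<pi>" "\<forall>\<pi>\<in>?M. Im (x \<pi>) = u * v \<pi>"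
        using Perron_vector_unique[OF v eig] by metis
      have "x \<pi> = Complex t u * of_real (v \<pi>)" if "\<pi> \<in> ?M" for \<pi>
        using tu that by (simp add: complex_eq_iff)
      then have "\<psi> = scale_state (Complex t u) \<Theta>"
        unfolding x \<Theta>_def scale_state_def sum_distrib_left by (intro ext sum.cong) auto
      then show "\<psi> \<in> state.span {\<Theta>}" by (auto simp: state.span_singleton)
    qed
  qed
  have expansion: "\<exists>c :: (nat \<times> nat) list \<Rightarrow> real. (\<forall>m\<in>noncrossing_matchings L. c m > 0) \<and>
      \<Theta> = (\<Sum>m\<in>noncrossing_matchings L. scale_state (of_real (c m)) (bracket_state L m))"
  proof (intro exI conjI ballI)
    let ?c = "\<lambda>m. v (the_inv_into ?M matching_list m)"
    have bij: "bij_betw matching_list ?M (noncrossing_matchings L)"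
      using \<open>even L\<close> by (rule bij_betw_matching_list)
    have c: "?c (matching_list \<pi>) = v \<pi>" if "\<pi> \<in> ?M" for \<pi>
      using that by (simp add: the_inv_into_f_f inj_on_matching_list)
    show "0 < ?c m" if m: "m \<in> noncrossing_matchings L" for m
    proof -
      obtain \<pi> where "\<pi> \<in> ?M" "m = matching_list \<pi>" using m bij by (auto simp: bij_betw_def)
      then show ?thesis using c v by simp
    qed
    show "\<Theta> = (\<Sum>m\<in>noncrossing_matchings L. scale_state (of_real (?c m)) (bracket_state L m))"
    proof
      fix \<sigma>
      have "(\<Sum>m\<in>noncrossing_matchings L. scale_state (of_real (?c m)) (bracket_state L m)) \<sigma> =
          (\<Sum>\<pi>\<in>?M. of_real (?c (matching_list \<pi>)) * bracket_state L (matching_list \<pi>) \<sigma>)"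
        unfolding sum_state_apply scale_state_def by (rule sum.reindex_bij_betw[OF bij, symmetric])
      also have "\<dots> = \<Theta> \<sigma>"
        unfolding \<Theta>_def by (intro sum.cong) (simp_all add: c bracket_state_matching_list)
      finally show "\<Theta> \<sigma> =
        (\<Sum>m\<in>noncrossing_matchings L. scale_state (of_real (?c m)) (bracket_state L m)) \<sigma>" ..
    qed
  qed
  show ?thesis
    unfolding spin_sector_0 E_min
    by (intro bexI[OF _ \<Theta>] conjI expansion H\<Theta> eigenspace)
qed

end
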